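(* Let $F=|y|\,\zeta\big(|x|,\frac{\langle x,y\rangle}{|y|}\big)$ be a spherically symmetric Finsler metric on a convex domain $\Omega\subseteq\mathbb{R}^n$. Then $F$ is locally projectively flat with constant flag curvature ${\bf K}=-1$ if and only if $$\begin{aligned}F=\frac12\Big\{&\frac{(c+1)^2\langle x,y\rangle+\mathrm{sgn}(c+1)\sqrt{(c+1)^2\big(1-(c+1)^2|x|^2\big)|y|^2+(c+1)^4\langle x,y\rangle^2}}{1-(c+1)^2|x|^2}\\&-\frac{(c-1)^2\langle x,y\rangle+\mathrm{sgn}(c-1)\sqrt{(c-1)^2\big(1-(c-1)^2|x|^2\big)|y|^2+(c-1)^4\langle x,y\rangle^2}}{1-(c-1)^2|x|^2}\Big\},\end{aligned}$$ where $c$ is a constant.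
   Context: $|\cdot|$ and $\langle\cdot,\cdot\rangle$ are the Euclidean norm and inner product on $\mathbb{R}^n$; $\mathrm{sgn}$ is the sign function. A Finsler metric $F$ on a convex domain $\Omega\subseteq\mathbb{R}^n$ is spherically symmetric if $F(Sx,Sy)=F(x,y)$ for all $S\in O(n)$; such an $F$ can be expressed as $|y|\zeta(|x|,\langle x,y\rangle/|y|)$ with $\zeta$ a $C^\infty$ function. Summation over repeated indices is understood; subscripts $x^k,y^k$ denote partial derivatives. A Finsler metric on $\Omega$ is a nonnegative function $F$ on $\Omega\times\mathbb{R}^n$, $C^\infty$ on $\Omega\times(\mathbb{R}^n\setminus\{0\})$, such that for each $x$: $F(x,y)=0$ iff $y=0$, $F(x,\lambda y)=\lambda F(x,y)$ for $\lambda>0$, and $g_{ij}=[\frac12F^2]_{y^iy^j}$ is positive definite for $y\ne0$. With $(g^{ij})=(g_{ij})^{-1}$, the geodesic coefficients are $G^i=\frac14 g^{il}\{[F^2]_{x^my^l}y^m-[F^2]_{x^l}\}$. $F$ is (locally) projectively flat if all its geodesics are straight lines, equivalently $G^i=P\,y^i$ with $P=F_{x^k}y^k/(2F)$. For a tangent plane $\Pi=\mathrm{span}\{y,u\}$ the flag curvature is ${\bf K}(\Pi,y)=\dfrac{g_{im}R^i_{\ k}u^ku^m}{F^2g_{ij}u^iu^j-[g_{ij}y^iu^j]^2}$, where $R^i_{\ k}=2\frac{\partial G^i}{\partial x^k}-y^j\frac{\partial^2G^i}{\partial x^j\partial y^k}+2G^j\frac{\partial^2G^i}{\partial y^j\partial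 y^k}-\frac{\partial G^i}{\partial y^j}\frac{\partial G^j}{\partial y^k}$; for projectively flat $F$ one has ${\bf K}=(P^2-P_{x^m}y^m)/F^2$.
   Formalization: The displayed F always has F(0,y)=|y|, so "only if" fails for rescaled metrics (e.g. Klein metric of the ball of radius 1/2). The formal version adds ζ(0,0)=1 to the left side, and also proves the equivalence without it, up to a dilation (x,y)→(rx,ry), r>0; n≥2. *)

theory Defs
  imports "HOL-Analysis.Analysis"
begin

text \<open>
  \<open>Ck_on k f S\<close> (for open \<open>S\<close>): all iterated partial derivatives of \<open>f\<close> of order at most \<open>k\<close>
  exist and are continuous on \<open>S\<close>.
\<close>

primrec Ck_on :: "nat \<Rightarrow> ('a::euclidean_space \<Rightarrow> real) \<Rightarrow> 'a set \<Rightarrow> bool" where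
  "Ck_on 0 f S \<longleftrightarrow> continuous_on S f"
| "Ck_on (Suc k) f S \<longleftrightarrow>
     (\<forall>x\<in>S. f differentiable (at x)) \<and>
     (\<forall>b\<in>Basis. Ck_on k (\<lambda>x. frechet_derivative f (at x) b) S)"

definition Cinf_on :: "('a::euclidean_space \<Rightarrow> real) \<Rightarrow> 'a set \<Rightarrow> bool" where
  "Cinf_on f S \<longleftrightarrow> (\<forall>k. Ck_on k f S)"

definition pdx :: "'n::finite \<Rightarrow> (real^'n \<Rightarrow> real^'n \<Rightarrow> real) \<Rightarrow> real^'n \<Rightarrow> real^'n \<Rightarrow> real" where
  "pdx k A x y = deriv (\<lambda>t. A (x + t *\<^sub>R axis k 1) y) 0"

definition pdy :: "'n::finite \<Rightarrow> (real^'n \<Rightarrow> real^'n \<Rightarrow> real) \<Rightarrow> real^'n \<Rightarrow> real^'n \<Rightarrow> real" where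
  "pdy k A x y = deriv (\<lambda>t. A x (y + t *\<^sub>R axis k 1)) 0"

definition fund_tensor ::
    "(real^'n::finite \<Rightarrow> real^'n \<Rightarrow> real) \<Rightarrow> real^'n \<Rightarrow> real^'n \<Rightarrow> real^'n^'n" where
  "fund_tensor F x y = (\<chi> i j. pdy j (pdy i (\<lambda>x y. (F x y)\<^sup>2 / 2)) x y)"

definition finsler_metric ::
    "(real^'n::finite) set \<Rightarrow> (real^'n \<Rightarrow> real^'n \<Rightarrow> real) \<Rightarrow> bool" where
  "finsler_metric \<Omega> F \<longleftrightarrow>
     Cinf_on (\<lambda>(x, y). F x y) (\<Omega> \<times> (UNIV - {0})) \<and>
     (\<forall>x\<in>\<Omega>.
        (\<forall>y. 0 \<le> F x y) \<and>
        (\<forall>y. F x y = 0 \<longleftrightarrow> y = 0) \<and>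
        (\<forall>y. \<forall>t>0. F x (t *\<^sub>R y) = t * F x y) \<and>
        (\<forall>y. y \<noteq> 0 \<longrightarrow> (\<forall>v. v \<noteq> 0 \<longrightarrow> 0 < v \<bullet> (fund_tensor F x y *v v))))"

text \<open>
  For \<open>F (S x) (S y)\<close> to make sense for every \<open>S\<close> in O(n), \<open>\<Omega>\<close> has to be invariant under O(n).
\<close>

definition spherically_symmetric ::
    "(real^'n::finite) set \<Rightarrow> (real^'n \<Rightarrow> real^'n \<Rightarrow> real) \<Rightarrow> bool" where
  "spherically_symmetric \<Omega> F \<longleftrightarrow>
     (\<forall>S. orthogonal_transformation S \<longrightarrow>
        (\<forall>x\<in>\<Omega>. S x \<in> \<Omega> \<and> (\<forall>y. F (S x) (S y) = F x y)))"

definition geodesic_coeff ::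
    "(real^'n::finite \<Rightarrow> real^'n \<Rightarrow> real) \<Rightarrow> 'n \<Rightarrow> real^'n \<Rightarrow> real^'n \<Rightarrow> real" where
  "geodesic_coeff F i x y =
     1 / 4 * (\<Sum>l\<in>UNIV. matrix_inv (fund_tensor F x y) $ i $ l *
       ((\<Sum>m\<in>UNIV. pdy l (pdx m (\<lambda>x y. (F x y)\<^sup>2)) x y * y $ m) - pdx l (\<lambda>x y. (F x y)\<^sup>2) x y))"

text \<open>
  Geodesics are the regular solutions, on an open interval, of
  \<open>\<gamma>''\<^sup>i + 2 G\<^sup>i(\<gamma>, \<gamma>') = 0\<close>; here \<open>v = \<gamma>'\<close>.
\<close>

definition geodesic ::
    "(real^'n::finite) set \<Rightarrow> (real^'n \<Rightarrow> real^'n \<Rightarrow> real) \<Rightarrow> real set \<Rightarrow> (real \<Rightarrow> real^'n) \<Rightarrow> bool" where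
  "geodesic \<Omega> F I \<gamma> \<longleftrightarrow>
     open I \<and> is_interval I \<and>
     (\<exists>v. \<forall>t\<in>I. \<gamma> t \<in> \<Omega> \<and> v t \<noteq> 0 \<and>
        (\<gamma> has_vector_derivative v t) (at t) \<and>
        (v has_vector_derivative (\<chi> i. - 2 * geodesic_coeff F i (\<gamma> t) (v t))) (at t))"

definition projectively_flat ::
    "(real^'n::finite) set \<Rightarrow> (real^'n \<Rightarrow> real^'n \<Rightarrow> real) \<Rightarrow> bool" where
  "projectively_flat \<Omega> F \<longleftrightarrow> (\<forall>I \<gamma>. geodesic \<Omega> F I \<gamma> \<longrightarrow> collinear (\<gamma> ` I))"

definition riemann_curvature ::
    "(real^'n::finite \<Rightarrow> real^'n \<Rightarrow> real) \<Rightarrow> 'n \<Rightarrow> 'n \<Rightarrow> real^'n \<Rightarrow> real^'n \<Rightarrow> real" where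
  "riemann_curvature F i k x y = (let G = geodesic_coeff F in
     2 * pdx k (G i) x y
     - (\<Sum>j\<in>UNIV. y $ j * pdy k (pdx j (G i)) x y)
     + 2 * (\<Sum>j\<in>UNIV. G j x y * pdy k (pdy j (G i)) x y)
     - (\<Sum>j\<in>UNIV. pdy j (G i) x y * pdy k (G j) x y))"

definition flag_curvature ::
    "(real^'n::finite \<Rightarrow> real^'n \<Rightarrow> real) \<Rightarrow> real^'n \<Rightarrow> real^'n \<Rightarrow> real^'n \<Rightarrow> real" where
  "flag_curvature F x y u = (let g = fund_tensor F x y in
     (\<Sum>i\<in>UNIV. \<Sum>m\<in>UNIV. \<Sum>k\<in>UNIV. g $ i $ m * riemann_curvature F i k x y * u $ k * u $ m) /
     ((F x y)\<^sup>2 * (\<Sum>i\<in>UNIV. \<Sum>j\<in>UNIV. g $ i $ j * u $ i * u $ j)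
      - (\<Sum>i\<in>UNIV. \<Sum>j\<in>UNIV. g $ i $ j * y $ i * u $ j)\<^sup>2))"

definition constant_flag_curvature ::
    "(real^'n::finite) set \<Rightarrow> (real^'n \<Rightarrow> real^'n \<Rightarrow> real) \<Rightarrow> real \<Rightarrow> bool" where
  "constant_flag_curvature \<Omega> F K \<longleftrightarrow>
     (\<forall>x\<in>\<Omega>. \<forall>y u. y \<noteq> 0 \<and> u \<notin> span {y} \<longrightarrow> flag_curvature F x y u = K)"

text \<open>
  \<open>sph_term k\<close> is the root \<open>\<Phi>\<close>, with the sign of \<open>k\<close>, of \<open>\<Phi> = k \<bar>y + \<Phi> x\<bar>\<close>
  (the Funk metric of the ball of radius \<open>1/k\<close> when \<open>k > 0\<close>).  On a convex O(n)-invariant domain on which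
  \<open>sph_metric c\<close> is a Finsler metric, both denominators are positive.
\<close>

definition sph_term :: "real \<Rightarrow> real^'n::finite \<Rightarrow> real^'n \<Rightarrow> real" where
  "sph_term k x y =
     (k^2 * (x \<bullet> y) + sgn k * sqrt (k^2 * (1 - k^2 * (norm x)^2) * (norm y)^2 + k^4 * (x \<bullet> y)^2))
     / (1 - k^2 * (norm x)^2)"

definition sph_metric :: "real \<Rightarrow> real^'n::finite \<Rightarrow> real^'n \<Rightarrow> real" where
  "sph_metric c x y = 1 / 2 * (sph_term (c + 1) x y - sph_term (c - 1) x y)"

end

theory Submission
  imports Defs
begin

text \<open>
  Both implications go through the first order system
  \<open>F\<^bsub>x\<^esub> = (P F)\<^bsub>y\<^esub>\<close>, \<open>P\<^bsub>x\<^esub> = P P\<^bsub>y\<^esub> + F F\<^bsub>y\<^esub>\<close>.  If all geodesics are straight, then \<open>G\<^sup>i = P y\<^sup>i\<close>, because by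
  Picard's theorem a geodesic starts in every direction.  Contracting the definition of \<open>G\<^sup>i\<close> with
  \<open>g\<^sub>i\<^sub>j\<close> and using Euler's identity gives the first equation, and
  \<open>R\<^sup>i\<^sub>k = \<Xi> \<delta>\<^sup>i\<^sub>k + \<tau>\<^sub>k y\<^sup>i\<close> with \<open>\<Xi> = P\<^sup>2 - P\<^bsub>x\<^esub> y\<close> and \<open>\<tau> = 3 P\<^bsub>x\<^esub> - (P\<^bsub>x\<^esub> y)\<^bsub>y\<^esub> - P P\<^bsub>y\<^esub>\<close>;
  curvature \<open>-1\<close> means \<open>\<Xi> = - F\<^sup>2\<close> and \<open>\<tau> = F F\<^bsub>y\<^esub>\<close>, which is the second equation.
  The system decouples for \<open>\<Phi> = P \<plusminus> F\<close> into \<open>\<Phi>\<^bsub>x\<^esub> = \<Phi> \<Phi>\<^bsub>y\<^esub>\<close>.  By symmetry \<open>\<Phi>(0, y) = k \<bar>y\<bar>\<close>, and the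
  method of characteristics yields \<open>\<Phi>(x, y) = k \<bar>y + \<Phi>(x, y) x\<bar>\<close>, a quadratic equation whose root of
  the right sign is \<open>sph_term k x y\<close>.
\<close>

section \<open>Calculus of smooth functions on the slit tangent bundle\<close>

text \<open>The differential equations leave two free constants \<open>p > q\<close> in
  \<open>F = (sph_term p - sph_term q) / 2\<close>, whereas the displayed formula has
  \<open>F(0, y) = |y|\<close>. Hence two equivalences: \<open>\<zeta> 0 0 = 1\<close> cuts out the
  displayed family, and the dilations \<open>x -> r x\<close>, which preserve straight lines and
  curvature and send the parameter \<open>k\<close> to \<open>k r\<close>, produce the general one,
  with \<open>p - q = 2 r\<close> and \<open>p + q = 2 c r\<close>. Two obstacles shape the proof.
  Smoothness holds only off the zero section, so geodesics and characteristics must avoid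
  \<open>y = 0\<close>; a characteristic can meet it when \<open>x\<close> and \<open>y\<close> are
  parallel, and that case is recovered by continuity from the other directions, which exist in
  dimension at least two. Moreover the closed formula has a value even where a denominator vanishes,
  because division by zero yields zero, so the formula alone does not confine
  \<open>\<Omega>\<close> to a ball. That bound is derived in each direction by a separate argument:
  unsolvability of the root equation on the critical sphere, and continuity of
  \<open>F\<close>.\<close>

lemma Ck_on_cong:
  assumes "open S" "\<And>z. z \<in> S \<Longrightarrow> f z = g z" "Ck_on k f S"
  shows "Ck_on k g S"
  using assms(2,3)
proof (induction k arbitrary: f g)
  case 0
  then show ?case using continuous_on_cong[of S S f g] by simp
next
  case (Suc k)
  have fr: "frechet_derivative f (at z) = frechet_derivative g (at z)" if "z \<in> S" for z
    using that Suc.prems assms(1)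
    by (intro frechet_derivative_transform_within_open[OF _ assms(1)]) auto
  have "g differentiable (at z)" if "z \<in> S" for z
  proof -
    have "(f has_derivative frechet_derivative f (at z)) (at z)"
      using Suc.prems(2) that frechet_derivative_works by (metis Ck_on.simps(2))
    then have "(g has_derivative frechet_derivative f (at z)) (at z)"
      by (rule has_derivative_transform_within_open[OF _ assms(1) that Suc.prems(1)])
    then show ?thesis
      by (auto simp: differentiable_def)
  qed
  moreover have "Ck_on k (\<lambda>z. frechet_derivative g (at z) b) S" if "b \<in> Basis" for b
    by (rule Suc.IH[where f = "\<lambda>z. frechet_derivative f (at z) b"])
      (use fr Suc.prems(2) that in auto)
  ultimately show ?case by simp
qed

text \<open>Not immediate, since the definition at order \<open>Suc k\<close> mentions only
  differentiability and the first partials. The product, inverse and root rules need it because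
  their derivatives contain undifferentiated factors.\<close>

lemma Ck_on_Suc_imp: "Ck_on (Suc k) f S \<Longrightarrow> Ck_on k f S"
proof (induction k arbitrary: f)
  case 0
  then show ?case
    by (auto simp: continuous_on_eq_continuous_within
        intro!: continuous_at_imp_continuous_at_within[OF differentiable_imp_continuous_within])
next
  case (Suc k)
  show ?case
    unfolding Ck_on.simps(2)[of k]
    using Suc.prems Suc.IH unfolding Ck_on.simps(2)[of "Suc k"] by blast
qed

lemma Ck_on_const: "Ck_on k (\<lambda>z. c) S"
proof (induction k arbitrary: c)
  case (Suc k)
  have "frechet_derivative (\<lambda>z. c) (at z) b = 0" for z b :: 'a
    by (simp add: frechet_derivative_const)
  with Suc show ?case by simp
qed simp

lemma Ck_on_bounded_linear:
  assumes "bounded_linear f"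
  shows "Ck_on k f S"
proof (cases k)
  case 0
  then show ?thesis
    using assms linear_continuous_on by auto
next
  case (Suc n)
  have "(f has_derivative f) (at z)" for z
    using assms bounded_linear_imp_has_derivative by blast
  then have "frechet_derivative f (at z) = f" "f differentiable (at z)" for z
    using frechet_derivative_at differentiable_def by (metis, blast)
  then show ?thesis
    using Suc by (simp add: Ck_on_const)
qed

lemma Ck_on_add:
  assumes "open S" "Ck_on k f S" "Ck_on k g S"
  shows "Ck_on k (\<lambda>z. f z + g z) S"
  using assms(2,3)
proof (induction k arbitrary: f g)
  case 0
  then show ?case by (auto intro: continuous_intros)
next
  case (Suc k)
  have "Ck_on k (\<lambda>z. frechet_derivative (\<lambda>z. f z + g z) (at z) b) S" if b: "b \<in> Basis" for b
  proof (rule Ck_on_cong[OF assms(1)])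
    show "Ck_on k (\<lambda>z. frechet_derivative f (at z) b + frechet_derivative g (at z) b) S"
      using Suc b by simp
    show "frechet_derivative f (at z) b + frechet_derivative g (at z) b
        = frechet_derivative (\<lambda>z. f z + g z) (at z) b" if "z \<in> S" for z
    proof -
      have "((\<lambda>z. f z + g z) has_derivative
          (\<lambda>h. frechet_derivative f (at z) h + frechet_derivative g (at z) h)) (at z)"
        using Suc.prems that by (intro has_derivative_add) (simp_all add: frechet_derivative_works[symmetric])
      then show ?thesis
        by (simp add: frechet_derivative_at[symmetric])
    qed
  qed
  then show ?case using Suc.prems by simp
qed

lemma Ck_on_mult:
  assumes "open S" "Ck_on k f S" "Ck_on k g S"
  shows "Ck_on k (\<lambda>z. f z * g z) S"
  using assms(2,3)
proof (induction k arbitrary: f g)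
  case 0
  then show ?case by (auto intro: continuous_intros)
next
  case (Suc k)
  have "Ck_on k (\<lambda>z. frechet_derivative (\<lambda>z. f z * g z) (at z) b) S" if b: "b \<in> Basis" for b
  proof (rule Ck_on_cong[OF assms(1)])
    show "Ck_on k (\<lambda>z. f z * frechet_derivative g (at z) b + frechet_derivative f (at z) b * g z) S"
      using Suc.prems b Ck_on_Suc_imp[OF Suc.prems(1)] Ck_on_Suc_imp[OF Suc.prems(2)]
      by (intro Ck_on_add[OF assms(1)] Suc.IH) auto
    show "f z * frechet_derivative g (at z) b + frechet_derivative f (at z) b * g z
        = frechet_derivative (\<lambda>z. f z * g z) (at z) b" if "z \<in> S" for z
    proof -
      have "((\<lambda>z. f z * g z) has_derivative
          (\<lambda>h. f z * frechet_derivative g (at z) h + frechet_derivative f (at z) h * g z)) (at z)"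
        using Suc.prems that by (intro has_derivative_mult) (simp_all add: frechet_derivative_works[symmetric])
      then show ?thesis
        by (simp add: frechet_derivative_at[symmetric])
    qed
  qed
  then show ?case using Suc.prems by simp
qed

text \<open>The derivative contains only \<open>inverse f\<close> and the derivative of
  \<open>f\<close>, so the induction on \<open>k\<close> keeps \<open>f\<close> fixed and meets
  \<open>inverse f\<close> again one order lower. \<open>Ck_on_sqrt\<close> works in the same way
  with \<open>inverse (sqrt f)\<close>.\<close>

lemma Ck_on_inverse:
  assumes "open S" "Ck_on k f S" "\<And>z. z \<in> S \<Longrightarrow> f z \<noteq> 0"
  shows "Ck_on k (\<lambda>z. inverse (f z)) S"
  using assms(2)
proof (induction k)
  case 0
  then show ?case using assms(3) by (auto intro: continuous_intros)
next
  case (Suc k)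
  have D: "((\<lambda>z. inverse (f z)) has_derivative
          (\<lambda>h. - (inverse (f z) * frechet_derivative f (at z) h * inverse (f z)))) (at z)"
    if "z \<in> S" for z
    using Suc.prems that assms(3)
    by (intro Deriv.has_derivative_inverse) (simp_all add: frechet_derivative_works[symmetric])
  have "Ck_on k (\<lambda>z. frechet_derivative (\<lambda>z. inverse (f z)) (at z) b) S" if b: "b \<in> Basis" for b
  proof (rule Ck_on_cong[OF assms(1)])
    show "Ck_on k (\<lambda>z. (-1) * (inverse (f z) * frechet_derivative f (at z) b * inverse (f z))) S"
      using Suc.prems b Suc.IH[OF Ck_on_Suc_imp[OF Suc.prems]]
      by (intro Ck_on_mult[OF assms(1)] Ck_on_const) auto
    show "(-1) * (inverse (f z) * frechet_derivative f (at z) b * inverse (f z))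
        = frechet_derivative (\<lambda>z. inverse (f z)) (at z) b" if "z \<in> S" for z
      using frechet_derivative_at[OF D[OF that]] by (metis mult_minus1)
  qed
  then show ?case using D by (auto simp: differentiable_def)
qed

lemma Ck_on_sqrt:
  assumes "open S" "Ck_on k f S" "\<And>z. z \<in> S \<Longrightarrow> f z > 0"
  shows "Ck_on k (\<lambda>z. sqrt (f z)) S"
  using assms(2)
proof (induction k)
  case 0
  then show ?case by (auto intro: continuous_intros)
next
  case (Suc k)
  have D: "((\<lambda>z. sqrt (f z)) has_derivative
      (\<lambda>h. (1 / 2 * inverse (sqrt (f z))) * frechet_derivative f (at z) h)) (at z)" if "z \<in> S" for z
  proof -
    have "(f has_derivative frechet_derivative f (at z)) (at z)"
      using Suc.prems that by (simp add: frechet_derivative_works[symmetric])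
    then show ?thesis
      using assms(3)[OF that] by (auto intro!: derivative_eq_intros simp: field_simps)
  qed
  have "Ck_on k (\<lambda>z. frechet_derivative (\<lambda>z. sqrt (f z)) (at z) b) S" if b: "b \<in> Basis" for b
  proof (rule Ck_on_cong[OF assms(1)])
    show "Ck_on k (\<lambda>z. (1 / 2 * inverse (sqrt (f z))) * frechet_derivative f (at z) b) S"
      using Suc.prems b assms(3) Suc.IH[OF Ck_on_Suc_imp[OF Suc.prems]]
      by (intro Ck_on_mult[OF assms(1)] Ck_on_inverse[OF assms(1)] Ck_on_const) force+
    show "(1 / 2 * inverse (sqrt (f z))) * frechet_derivative f (at z) b
        = frechet_derivative (\<lambda>z. sqrt (f z)) (at z) b" if "z \<in> S" for z
      using frechet_derivative_at[OF D[OF that]] by metis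
  qed
  then show ?case using D by (auto simp: differentiable_def)
qed

section \<open>Partial derivatives and the chain rule in coordinates\<close>

lemma axis_decomp: "v = (\<Sum>k\<in>UNIV. v $ k *\<^sub>R axis k (1::real))"
  by (simp add: vec_eq_iff axis_def if_distrib cong: if_cong)

lemma pair_decomp:
  fixes a b :: "real^'n::finite"
  shows "(a, b) = (\<Sum>k\<in>UNIV. a $ k *\<^sub>R (axis k 1, 0)) + (\<Sum>k\<in>UNIV. b $ k *\<^sub>R (0, axis k 1))"
  by (simp add: prod_eq_iff fst_sum snd_sum axis_decomp[symmetric])

lemma curve_has_derivative:
  assumes "(f has_derivative D) (at (\<alpha> t, \<beta> t))"
    and "(\<alpha> has_vector_derivative a) (at t)" "(\<beta> has_vector_derivative b) (at t)"
  shows "((\<lambda>t. f (\<alpha> t, \<beta> t)) has_real_derivative D (a, b)) (at t)"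
proof -
  have "((\<lambda>t. (\<alpha> t, \<beta> t)) has_derivative (\<lambda>h. (h *\<^sub>R a, h *\<^sub>R b))) (at t)"
    using assms(2,3) unfolding has_vector_derivative_def by (rule has_derivative_Pair)
  from diff_chain_at[OF this] assms(1)
  have "(f \<circ> (\<lambda>t. (\<alpha> t, \<beta> t)) has_derivative D \<circ> (\<lambda>h. h *\<^sub>R (a, b))) (at t)"
    by (simp add: o_def scaleR_prod_def)
  moreover have "D \<circ> (\<lambda>h. h *\<^sub>R (a, b)) = (*) (D (a, b))"
    using linear_cmul[OF has_derivative_linear[OF assms(1)]] by (auto simp: o_def simp del: scaleR_Pair)
  ultimately show ?thesis
    by (simp add: has_field_derivative_def o_def)
qed

lemma
  assumes "(f has_derivative D) (at (x, y))"
  shows DERIV_fst_line: "((\<lambda>t. f (x + t *\<^sub>R v, y)) has_real_derivative D (v, 0)) (at 0)"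
    and DERIV_snd_line: "((\<lambda>t. f (x, y + t *\<^sub>R v)) has_real_derivative D (0, v)) (at 0)"
  using assms
  by (auto intro!: curve_has_derivative derivative_eq_intros)

lemma
  assumes "(\<lambda>(x, y). A x y) differentiable (at (x, y))"
  shows pdx_frechet: "pdx k A x y = frechet_derivative (\<lambda>(x, y). A x y) (at (x, y)) (axis k 1, 0)"
    and pdy_frechet: "pdy k A x y = frechet_derivative (\<lambda>(x, y). A x y) (at (x, y)) (0, axis k 1)"
    and DERIV_pdx: "((\<lambda>t. A (x + t *\<^sub>R axis k 1) y) has_real_derivative pdx k A x y) (at 0)"
    and DERIV_pdy: "((\<lambda>t. A x (y + t *\<^sub>R axis k 1)) has_real_derivative pdy k A x y) (at 0)"
proof -
  have D: "((\<lambda>(x, y). A x y) has_derivative frechet_derivative (\<lambda>(x, y). A x y) (at (x, y))) (at (x, y))"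
    using assms frechet_derivative_works by blast
  note d = DERIV_fst_line[OF D, of "axis k 1"] DERIV_snd_line[OF D, of "axis k 1"]
  show 1: "pdx k A x y = frechet_derivative (\<lambda>(x, y). A x y) (at (x, y)) (axis k 1, 0)"
    using d(1) by (simp add: pdx_def DERIV_imp_deriv)
  show 2: "pdy k A x y = frechet_derivative (\<lambda>(x, y). A x y) (at (x, y)) (0, axis k 1)"
    using d(2) by (simp add: pdy_def DERIV_imp_deriv)
  show "((\<lambda>t. A (x + t *\<^sub>R axis k 1) y) has_real_derivative pdx k A x y) (at 0)"
    "((\<lambda>t. A x (y + t *\<^sub>R axis k 1)) has_real_derivative pdy k A x y) (at 0)"
    using d 1 2 by simp_all
qed

text \<open>Applied to the curves \<open>(x, t y)\<close>, \<open>(t y, y)\<close> and the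
  characteristics, this gives Euler's identity, the value of \<open>P\<close> over the origin and
  the linear ODE of \<open>funk_generic\<close>.\<close>

lemma DERIV_curve:
  fixes \<alpha> \<beta> :: "real \<Rightarrow> real^'n::finite"
  assumes "(\<lambda>(x, y). A x y) differentiable (at (\<alpha> t, \<beta> t))"
    and "(\<alpha> has_vector_derivative a) (at t)" "(\<beta> has_vector_derivative b) (at t)"
  shows "((\<lambda>t. A (\<alpha> t) (\<beta> t)) has_real_derivative
    (\<Sum>k\<in>UNIV. a $ k * pdx k A (\<alpha> t) (\<beta> t)) + (\<Sum>k\<in>UNIV. b $ k * pdy k A (\<alpha> t) (\<beta> t))) (at t)"
proof -
  let ?D = "frechet_derivative (\<lambda>(x, y). A x y) (at (\<alpha> t, \<beta> t))"
  have D: "((\<lambda>(x, y). A x y) has_derivative ?D) (at (\<alpha> t, \<beta> t))"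
    using assms frechet_derivative_works by blast
  have lin: "linear ?D"
    using D has_derivative_linear by blast
  have "?D (a, b) = (\<Sum>k\<in>UNIV. a $ k * pdx k A (\<alpha> t) (\<beta> t)) + (\<Sum>k\<in>UNIV. b $ k * pdy k A (\<alpha> t) (\<beta> t))"
    unfolding pair_decomp[of a b] pdx_frechet[OF assms(1)] pdy_frechet[OF assms(1)]
    by (simp only: linear_add[OF lin] linear_sum[OF lin] linear_cmul[OF lin] o_def real_scaleR_def)
  with curve_has_derivative[OF D assms(2,3)] show ?thesis by simp
qed

section \<open>Smooth and homogeneous functions off the zero section\<close>

locale slit_domain =
  fixes \<Omega> :: "(real^'n::finite) set"
  assumes open_domain: "open \<Omega>"
begin

definition smooth :: "(real^'n \<Rightarrow> real^'n \<Rightarrow> real) \<Rightarrow> bool" where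
  "smooth A \<longleftrightarrow> Cinf_on (\<lambda>(x, y). A x y) (\<Omega> \<times> (UNIV - {0}))"

lemma open_slit: "open (\<Omega> \<times> (UNIV - {0 :: real^'n}))"
  using open_domain by (intro open_Times open_delete open_UNIV)

lemma smooth_differentiable:
  assumes "smooth A" "x \<in> \<Omega>" "y \<noteq> 0"
  shows "(\<lambda>(x, y). A x y) differentiable (at (x, y))"
proof -
  have "Ck_on (Suc 0) (\<lambda>(x, y). A x y) (\<Omega> \<times> (UNIV - {0}))"
    using assms(1) unfolding smooth_def Cinf_on_def by blast
  then show ?thesis using assms by auto
qed

lemma smooth_isCont:
  assumes "smooth A" "x \<in> \<Omega>" "y \<noteq> 0"
  shows "isCont (\<lambda>(x, y). A x y) (x, y)"
  using smooth_differentiable[OF assms] differentiable_imp_continuous_within by blast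

lemma smooth_cong:
  assumes "smooth A" "\<And>x y. x \<in> \<Omega> \<Longrightarrow> y \<noteq> 0 \<Longrightarrow> A x y = B x y"
  shows "smooth B"
  unfolding smooth_def Cinf_on_def
proof
  fix k
  show "Ck_on k (\<lambda>(x, y). B x y) (\<Omega> \<times> (UNIV - {0}))"
    using assms(1) Ck_on_cong[OF open_slit, of "\<lambda>(x, y). A x y" "\<lambda>(x, y). B x y" k] assms(2)
    unfolding smooth_def Cinf_on_def by auto
qed

lemma
  assumes "smooth A"
  shows smooth_pdx: "smooth (pdx k A)" and smooth_pdy: "smooth (pdy k A)"
proof -
  let ?f = "\<lambda>(x, y). A x y" and ?S = "\<Omega> \<times> (UNIV - {0 :: real^'n})"
  have Basis: "(axis k 1 :: real^'n, 0 :: real^'n) \<in> Basis" "(0 :: real^'n, axis k 1 :: real^'n) \<in> Basis"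
    by (auto simp: Basis_prod_def axis_in_Basis_iff image_iff Basis_real_def)
  have D: "Ck_on m (\<lambda>z. frechet_derivative ?f (at z) b) ?S" if "b \<in> Basis" for m b
  proof -
    have "Ck_on (Suc m) ?f ?S"
      using assms unfolding smooth_def Cinf_on_def by blast
    then show ?thesis using that by auto
  qed
  show "smooth (pdx k A)"
    unfolding smooth_def Cinf_on_def
  proof
    fix m
    show "Ck_on m (\<lambda>(x, y). pdx k A x y) ?S"
    proof (rule Ck_on_cong[OF open_slit _ D[OF Basis(1), of m]])
      fix z :: "(real^'n) \<times> (real^'n)"
      assume "z \<in> ?S"
      then have "?f differentiable (at (fst z, snd z))"
        by (intro smooth_differentiable[OF assms]) auto
      from pdx_frechet[OF this, of k]
      show "frechet_derivative ?f (at z) (axis k 1, 0) = (case z of (x, y) \<Rightarrow> pdx k A x y)"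
        by (simp add: case_prod_unfold)
    qed
  qed
  show "smooth (pdy k A)"
    unfolding smooth_def Cinf_on_def
  proof
    fix m
    show "Ck_on m (\<lambda>(x, y). pdy k A x y) ?S"
    proof (rule Ck_on_cong[OF open_slit _ D[OF Basis(2), of m]])
      fix z :: "(real^'n) \<times> (real^'n)"
      assume "z \<in> ?S"
      then have "?f differentiable (at (fst z, snd z))"
        by (intro smooth_differentiable[OF assms]) auto
      from pdy_frechet[OF this, of k]
      show "frechet_derivative ?f (at z) (0, axis k 1) = (case z of (x, y) \<Rightarrow> pdy k A x y)"
        by (simp add: case_prod_unfold)
    qed
  qed
qed

lemma smooth_const: "smooth (\<lambda>x y. c)"
  by (simp add: smooth_def Cinf_on_def case_prod_unfold Ck_on_const)

lemma smooth_coord: "smooth (\<lambda>x y. y $ i)"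
  unfolding smooth_def Cinf_on_def case_prod_unfold
  by (auto intro!: Ck_on_bounded_linear bounded_linear_compose[OF bounded_linear_vec_nth bounded_linear_snd])

lemma smooth_add: "smooth A \<Longrightarrow> smooth B \<Longrightarrow> smooth (\<lambda>x y. A x y + B x y)"
  unfolding smooth_def Cinf_on_def case_prod_unfold
  by (intro allI Ck_on_add[OF open_slit]) blast+

lemma smooth_mult: "smooth A \<Longrightarrow> smooth B \<Longrightarrow> smooth (\<lambda>x y. A x y * B x y)"
  unfolding smooth_def Cinf_on_def case_prod_unfold
  by (intro allI Ck_on_mult[OF open_slit]) blast+

lemma smooth_inverse:
  assumes "smooth A" "\<And>x y. x \<in> \<Omega> \<Longrightarrow> y \<noteq> 0 \<Longrightarrow> A x y \<noteq> 0"
  shows "smooth (\<lambda>x y. inverse (A x y))"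
  using Ck_on_inverse[OF open_slit, of _ "\<lambda>(x, y). A x y"] assms
  by (auto simp: smooth_def Cinf_on_def case_prod_unfold)

lemma smooth_divide:
  assumes "smooth A" "smooth B" "\<And>x y. x \<in> \<Omega> \<Longrightarrow> y \<noteq> 0 \<Longrightarrow> B x y \<noteq> 0"
  shows "smooth (\<lambda>x y. A x y / B x y)"
  using smooth_mult[OF assms(1) smooth_inverse[OF assms(2,3)]] by (simp add: divide_inverse)

lemma smooth_diff: "smooth A \<Longrightarrow> smooth B \<Longrightarrow> smooth (\<lambda>x y. A x y - B x y)"
  using smooth_add[of A "\<lambda>x y. (-1) * B x y"] smooth_mult[OF smooth_const, of B "-1"] by simp

lemma smooth_power2: "smooth A \<Longrightarrow> smooth (\<lambda>x y. (A x y)\<^sup>2)"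
  using smooth_mult[of A A] by (simp add: power2_eq_square)

lemma smooth_sum:
  assumes "\<And>i. i \<in> I \<Longrightarrow> smooth (A i)"
  shows "smooth (\<lambda>x y. \<Sum>i\<in>I. A i x y)"
  using assms by (induction I rule: infinite_finite_induct) (auto intro: smooth_const smooth_add)

lemma smooth_prod:
  assumes "\<And>i. i \<in> I \<Longrightarrow> smooth (A i)"
  shows "smooth (\<lambda>x y. \<Prod>i\<in>I. A i x y)"
  using assms by (induction I rule: infinite_finite_induct) (auto intro: smooth_const smooth_mult)

lemma smooth_sqrt:
  assumes "smooth A" "\<And>x y. x \<in> \<Omega> \<Longrightarrow> y \<noteq> 0 \<Longrightarrow> A x y > 0"
  shows "smooth (\<lambda>x y. sqrt (A x y))"
  using Ck_on_sqrt[OF open_slit, of _ "\<lambda>(x, y). A x y"] assms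
  by (auto simp: smooth_def Cinf_on_def case_prod_unfold)

lemma smooth_base_coord: "smooth (\<lambda>x y. x $ i)"
  unfolding smooth_def Cinf_on_def case_prod_unfold
  by (auto intro!: Ck_on_bounded_linear bounded_linear_compose[OF bounded_linear_vec_nth bounded_linear_fst])

lemma smooth_inner: "smooth (\<lambda>x y. x \<bullet> y)" "smooth (\<lambda>x y. (norm x)\<^sup>2)" "smooth (\<lambda>x y. (norm y)\<^sup>2)"
  unfolding power2_norm_eq_inner inner_vec_def inner_real_def
  by (intro smooth_sum smooth_mult smooth_coord smooth_base_coord)+

text \<open>Prepares Cramer's rule in \<open>geodesic_coeff_smooth\<close>.\<close>

lemma smooth_det:
  assumes "\<And>i j. smooth (\<lambda>x y. M x y $ i $ j)"
  shows "smooth (\<lambda>x y. det (M x y :: real^'n^'n))"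
  unfolding det_def using assms by (intro smooth_sum smooth_mult smooth_prod smooth_const)

lemmas smooth_intros = smooth_pdx smooth_pdy smooth_const smooth_coord smooth_add smooth_mult
  smooth_diff smooth_power2 smooth_sum

lemma eventually_slit_line:
  fixes x y a b :: "real^'n"
  assumes "x \<in> \<Omega>" "y \<noteq> 0"
  shows "\<forall>\<^sub>F t in nhds 0. x + t *\<^sub>R a \<in> \<Omega>" "\<forall>\<^sub>F t in nhds 0. y + t *\<^sub>R b \<noteq> 0"
proof -
  have "((\<lambda>t. x + t *\<^sub>R a) \<longlongrightarrow> x + 0 *\<^sub>R a) (nhds 0)" "((\<lambda>t. y + t *\<^sub>R b) \<longlongrightarrow> y + 0 *\<^sub>R b) (nhds 0)"
    by (intro tendsto_intros filterlim_ident)+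
  then show "\<forall>\<^sub>F t in nhds 0. x + t *\<^sub>R a \<in> \<Omega>" "\<forall>\<^sub>F t in nhds 0. y + t *\<^sub>R b \<noteq> 0"
    using assms open_domain
    by (auto dest: topological_tendstoD[where S = \<Omega>] tendsto_imp_eventually_ne)
qed

lemma
  assumes "\<And>x y. x \<in> \<Omega> \<Longrightarrow> y \<noteq> 0 \<Longrightarrow> A x y = B x y" "x \<in> \<Omega>" "y \<noteq> 0"
  shows pdx_cong: "pdx k A x y = pdx k B x y" and pdy_cong: "pdy k A x y = pdy k B x y"
proof -
  show "pdx k A x y = pdx k B x y"
    unfolding pdx_def using assms eventually_slit_line(1)[OF assms(2,3), of "axis k 1"]
    by (intro deriv_cong_ev) (auto elim!: eventually_mono)
  show "pdy k A x y = pdy k B x y"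
    unfolding pdy_def using assms eventually_slit_line(2)[OF assms(2,3), of "axis k 1"]
    by (intro deriv_cong_ev) (auto elim!: eventually_mono)
qed

lemma
  assumes "smooth A" "x \<in> \<Omega>" "y \<noteq> 0"
  shows DERIV_x: "((\<lambda>t. A (x + t *\<^sub>R axis k 1) y) has_real_derivative pdx k A x y) (at 0)"
    and DERIV_y: "((\<lambda>t. A x (y + t *\<^sub>R axis k 1)) has_real_derivative pdy k A x y) (at 0)"
  using smooth_differentiable[OF assms] DERIV_pdx DERIV_pdy by blast+

context
  fixes A B :: "real^'n \<Rightarrow> real^'n \<Rightarrow> real" and x y :: "real^'n"
  assumes A: "smooth A" and B: "smooth B" and xy: "x \<in> \<Omega>" "y \<noteq> 0"
begin

lemma
  shows pdx_add: "pdx k (\<lambda>x y. A x y + B x y) x y = pdx k A x y + pdx k B x y"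
    and pdy_add: "pdy k (\<lambda>x y. A x y + B x y) x y = pdy k A x y + pdy k B x y"
    and pdx_diff: "pdx k (\<lambda>x y. A x y - B x y) x y = pdx k A x y - pdx k B x y"
    and pdy_diff: "pdy k (\<lambda>x y. A x y - B x y) x y = pdy k A x y - pdy k B x y"
    and pdx_mult: "pdx k (\<lambda>x y. A x y * B x y) x y = pdx k A x y * B x y + A x y * pdx k B x y"
    and pdy_mult: "pdy k (\<lambda>x y. A x y * B x y) x y = pdy k A x y * B x y + A x y * pdy k B x y"
  by (subst pdx_def pdy_def, rule DERIV_imp_deriv,
      auto intro!: derivative_eq_intros DERIV_x[OF A xy] DERIV_x[OF B xy] DERIV_y[OF A xy] DERIV_y[OF B xy])+

end

lemma
  shows pdx_const: "pdx k (\<lambda>x y. c) x y = 0" and pdy_const: "pdy k (\<lambda>x y. c) x y = 0"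
    and pdx_coord: "pdx k (\<lambda>x y. y $ i) x y = 0"
    and pdy_coord: "pdy k (\<lambda>x y. y $ i) x y = (if i = k then 1 else 0)"
  by (subst pdx_def pdy_def, rule DERIV_imp_deriv, auto intro!: derivative_eq_intros simp: axis_def)+

lemma pdy_sum:
  assumes "\<And>i. i \<in> I \<Longrightarrow> smooth (A i)" "x \<in> \<Omega>" "y \<noteq> 0"
  shows "pdy k (\<lambda>x y. \<Sum>i\<in>I. A i x y) x y = (\<Sum>i\<in>I. pdy k (A i) x y)"
  using assms
  by (subst pdy_def, intro DERIV_imp_deriv DERIV_sum) (auto intro: DERIV_y)

lemma
  assumes "smooth A" "x \<in> \<Omega>" "y \<noteq> 0"
  shows pdx_power2: "pdx k (\<lambda>x y. (A x y)\<^sup>2) x y = 2 * A x y * pdx k A x y"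
    and pdy_power2: "pdy k (\<lambda>x y. (A x y)\<^sup>2) x y = 2 * A x y * pdy k A x y"
  unfolding power2_eq_square
  using pdx_mult[OF assms(1,1,2,3)] pdy_mult[OF assms(1,1,2,3)] by simp_all

text \<open>The product rule for a contraction with \<open>y\<close>. It trades the contracted
  second derivatives in the spray, the fundamental tensor and the curvature for one derivative of a
  contraction, and keeps the derivatives in the order in which they are written.\<close>

lemma pdy_contract:
  assumes "\<And>m. smooth (A m)" "x \<in> \<Omega>" "y \<noteq> 0"
  shows "(\<Sum>m\<in>UNIV. pdy l (A m) x y * y $ m) = pdy l (\<lambda>x y. \<Sum>m\<in>UNIV. A m x y * y $ m) x y - A l x y"
proof -
  have "pdy l (\<lambda>x y. \<Sum>m\<in>UNIV. A m x y * y $ m) x y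
      = (\<Sum>m\<in>UNIV. pdy l (A m) x y * y $ m + (if m = l then A m x y else 0))"
    using assms by (subst pdy_sum) (auto intro!: smooth_intros sum.cong simp: pdy_mult smooth_coord pdy_coord)
  then show ?thesis
    by (simp add: sum.distrib)
qed

definition homogeneous :: "nat \<Rightarrow> (real^'n \<Rightarrow> real^'n \<Rightarrow> real) \<Rightarrow> bool" where
  "homogeneous p A \<longleftrightarrow> (\<forall>x\<in>\<Omega>. \<forall>y t. y \<noteq> 0 \<longrightarrow> t > 0 \<longrightarrow> A x (t *\<^sub>R y) = t ^ p * A x y)"

lemma euler:
  assumes "smooth A" "homogeneous p A" "x \<in> \<Omega>" "y \<noteq> 0"
  shows "(\<Sum>k\<in>UNIV. pdy k A x y * y $ k) = p * A x y"
proof -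
  have "((\<lambda>t. A x (t *\<^sub>R y)) has_real_derivative
      (\<Sum>k\<in>UNIV. 0 $ k * pdx k A x (1 *\<^sub>R y)) + (\<Sum>k\<in>UNIV. y $ k * pdy k A x (1 *\<^sub>R y))) (at 1)"
    using assms by (intro DERIV_curve) (auto intro!: smooth_differentiable derivative_eq_intros)
  moreover have "((\<lambda>t. A x (t *\<^sub>R y)) has_real_derivative p * A x y) (at 1)"
  proof (rule DERIV_cong_ev[THEN iffD1, OF refl _ refl])
    show "\<forall>\<^sub>F t in nhds 1. t ^ p * A x y = A x (t *\<^sub>R y)"
      using eventually_nhds_in_open[of "{0<..}" "1::real"] assms unfolding homogeneous_def
      by (auto elim!: eventually_mono)
    show "((\<lambda>t. t ^ p * A x y) has_real_derivative p * A x y) (at 1)"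
      by (auto intro!: derivative_eq_intros)
  qed
  ultimately show ?thesis
    by (metis (no_types, lifting) DERIV_unique mult.commute scaleR_one sum.cong sum.neutral
        add_0 mult_zero_left zero_index)
qed

lemma homogeneous_pdx:
  assumes "smooth A" "homogeneous p A"
  shows "homogeneous p (pdx k A)"
  unfolding homogeneous_def
proof (intro ballI allI impI)
  fix x y :: "real^'n" and t :: real
  assume *: "x \<in> \<Omega>" "y \<noteq> 0" "t > 0"
  have "pdx k A x (t *\<^sub>R y) = deriv (\<lambda>s. t ^ p * A (x + s *\<^sub>R axis k 1) y) 0"
    unfolding pdx_def using * assms(2) eventually_slit_line(1)[OF *(1,2), of "axis k 1"]
    by (intro deriv_cong_ev) (auto elim!: eventually_mono simp: homogeneous_def)
  also have "\<dots> = t ^ p * pdx k A x y"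
    using DERIV_x[OF assms(1) *(1,2)] by (intro DERIV_imp_deriv DERIV_cmult)
  finally show "pdx k A x (t *\<^sub>R y) = t ^ p * pdx k A x y" .
qed

lemma homogeneous_pdy:
  assumes "smooth A" "homogeneous (Suc p) A"
  shows "homogeneous p (pdy k A)"
  unfolding homogeneous_def
proof (intro ballI allI impI)
  fix x y :: "real^'n" and t :: real
  assume *: "x \<in> \<Omega>" "y \<noteq> 0" "t > 0"
  \<comment> \<open>Stretching the base point by \<open>t\<close> shortens the increment to
    \<open>s / t\<close>; the resulting chain rule factor \<open>1 / t\<close> lowers the degree by
    one.\<close>
  have eq: "t *\<^sub>R y + s *\<^sub>R axis k 1 = t *\<^sub>R (y + (s / t) *\<^sub>R axis k 1)" for s
    using * by (simp add: scaleR_add_right)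
  have "((\<lambda>s. A x (y + (s / t) *\<^sub>R axis k 1)) has_real_derivative pdy k A x y * (1 / t)) (at 0)"
    using * DERIV_y[OF assms(1) *(1,2)]
    by (intro DERIV_chain2[where f = "\<lambda>s. A x (y + s *\<^sub>R axis k 1)" and g = "\<lambda>s. s / t"])
      (auto intro!: derivative_eq_intros)
  then have "((\<lambda>s. t ^ Suc p * A x (y + (s / t) *\<^sub>R axis k 1)) has_real_derivative
      t ^ Suc p * (pdy k A x y * (1 / t))) (at 0)"
    by (rule DERIV_cmult)
  moreover have "pdy k A x (t *\<^sub>R y) = deriv (\<lambda>s. t ^ Suc p * A x (y + (s / t) *\<^sub>R axis k 1)) 0"
    unfolding pdy_def eq
    using eventually_slit_line(2)[OF *(1,2), of "(1 / t) *\<^sub>R axis k 1"] * assms(2)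
    by (intro deriv_cong_ev) (auto elim!: eventually_mono simp: homogeneous_def)
  ultimately show "pdy k A x (t *\<^sub>R y) = t ^ p * pdy k A x y"
    using * by (simp add: DERIV_imp_deriv)
qed

end

section \<open>Ordinary differential equations\<close>

text \<open>Integrating factor: with \<open>g' = a\<close> the product \<open>f * exp (- g)\<close>
  is constant. The lemma serves both the straightness of geodesics and the constancy of solutions
  along characteristics.\<close>

lemma linear_ode_zero:
  fixes f a :: "real \<Rightarrow> real"
  assumes deriv: "\<And>t. t \<in> {p..q} \<Longrightarrow> (f has_real_derivative a t * f t) (at t within {p..q})"
    and cont: "continuous_on {p..q} a"
    and zero: "s \<in> {p..q}" "f s = 0"
    and t: "t \<in> {p..q}"
  shows "f t = 0"
proof -
  obtain g where "\<And>t. t \<in> {p..q} \<Longrightarrow> (g has_vector_derivative a t) (at t within {p..q})"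
    using antiderivative_continuous[OF cont] by blast
  then have g: "(g has_real_derivative a t) (at t within {p..q})" if "t \<in> {p..q}" for t
    using that by (simp add: has_real_derivative_iff_has_vector_derivative)
  have "((\<lambda>t. f t * exp (- g t)) has_real_derivative 0) (at t within {p..q})" if "t \<in> {p..q}" for t
    using deriv[OF that] g[OF that] by (auto intro!: derivative_eq_intros simp: algebra_simps)
  then obtain c where "\<And>t. t \<in> {p..q} \<Longrightarrow> f t * exp (- g t) = c"
    using has_field_derivative_zero_constant[of "{p..q}" "\<lambda>t. f t * exp (- g t)"] by auto
  from this[OF zero(1)] this[OF t] zero(2) show ?thesis by simp
qed

text \<open>Precomposition with the projection onto the ball makes the vector field globally Lipschitz.\<close>

lemma picard_lindelof:
  fixes f :: "'a::euclidean_space \<Rightarrow> 'a"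
  assumes r: "0 < r" and lip: "L-lipschitz_on (cball z\<^sub>0 r) f"
  obtains \<delta> z where "\<delta> > 0" "z 0 = z\<^sub>0"
    "\<And>t. t \<in> {-\<delta><..<\<delta>} \<Longrightarrow> z t \<in> cball z\<^sub>0 r \<and> (z has_vector_derivative f (z t)) (at t)"
proof -
  define g where "g w = f (closest_point (cball z\<^sub>0 r) w)" for w
  have cp: "closest_point (cball z\<^sub>0 r) w \<in> cball z\<^sub>0 r" for w
    using r by (intro closest_point_in_set) auto
  have L: "0 \<le> L"
    using lip lipschitz_on_nonneg by blast
  have g_lip: "norm (g v - g w) \<le> L * norm (v - w)" for v w
  proof -
    have "norm (g v - g w) \<le> L * dist (closest_point (cball z\<^sub>0 r) v) (closest_point (cball z\<^sub>0 r) w)"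
      unfolding g_def using lipschitz_onD[OF lip cp cp] by (simp add: dist_norm)
    also have "\<dots> \<le> L * dist v w"
      using L r by (intro mult_left_mono closest_point_lipschitz) auto
    finally show ?thesis by (simp add: dist_norm)
  qed
  have g_cont: "continuous_on S (\<lambda>t. g (u t))" if "continuous_on S u" for S and u :: "real \<Rightarrow> 'a"
  proof -
    have "L-lipschitz_on UNIV g"
      using g_lip L by (auto intro!: lipschitz_onI simp: dist_norm)
    then show ?thesis
      using lipschitz_on_continuous_on continuous_on_compose2 that by (metis subset_UNIV)
  qed
  define M where "M = norm (f z\<^sub>0) + L * r"
  have M: "0 \<le> M"
    using L r by (simp add: M_def)
  have g_bound: "norm (g w) \<le> M" for w
  proof -
    have "norm (g w - f z\<^sub>0) \<le> L * dist (closest_point (cball z\<^sub>0 r) w) z\<^sub>0"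
      unfolding g_def using lipschitz_onD[OF lip cp, of z\<^sub>0] r by (simp add: dist_norm)
    also have "\<dots> \<le> L * r"
      using cp[of w] L by (intro mult_left_mono) (auto simp: dist_commute)
    finally show ?thesis
      using norm_triangle_ineq2[of "g w" "f z\<^sub>0"] by (simp add: M_def)
  qed
  \<comment> \<open>The first bound makes the integral operator contract by 1/2, the second keeps
    the fixed point in the ball. Both are used through \<open>4 * \<delta>\<close>: two integrals,
    each over an interval of length at most \<open>2 * \<delta>\<close>.\<close>
  define \<delta> where "\<delta> = min (1 / (8 * (L + 1))) (r / (4 * (M + 1)))"
  have \<delta>: "\<delta> > 0"
    using L M r by (simp add: \<delta>_def)
  have "4 * \<delta> * L \<le> 4 * (1 / (8 * (L + 1))) * L"
    using L by (intro mult_right_mono mult_left_mono) (auto simp: \<delta>_def)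
  also have "\<dots> \<le> 1 / 2"
    using L by (simp add: field_simps)
  finally have \<delta>L: "4 * \<delta> * L \<le> 1 / 2" .
  have "4 * \<delta> * M \<le> 4 * (r / (4 * (M + 1))) * M"
    using M by (intro mult_right_mono mult_left_mono) (auto simp: \<delta>_def)
  also have "\<dots> \<le> r"
    using M r by (simp add: field_simps)
  finally have \<delta>M: "4 * \<delta> * M \<le> r" .
  have int: "(\<lambda>s. g (u s)) integrable_on {p..q}" if "continuous_on UNIV u" for u :: "real \<Rightarrow> 'a" and p q
    using continuous_on_subset[OF g_cont[OF that] subset_UNIV] integrable_continuous_real by blast
  \<comment> \<open>The integral from 0 to \<open>t\<close> for either sign of \<open>t\<close>,
    written as a difference of two integrals that start at \<open>-\<delta>\<close>.\<close>
  define J where "J u t = z\<^sub>0 + integral {-\<delta>..t} (\<lambda>s. g (u s)) - integral {-\<delta>..0} (\<lambda>s. g (u s))" for u t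
  have J_cont: "continuous_on {-\<delta>..\<delta>} (J u)" if "continuous_on UNIV u" for u :: "real \<Rightarrow> 'a"
    unfolding J_def by (intro continuous_intros indefinite_integral_continuous_1 int that)
  \<comment> \<open>The Banach fixed point theorem is applied in the complete space of bounded
    continuous functions on the whole line; \<open>clamp\<close> extends \<open>J\<close> from the
    interval by its end values.\<close>
  define T where "T u = Bcontfun (\<lambda>t. J (apply_bcontfun u) (clamp (-\<delta>) \<delta> t))" for u :: "real \<Rightarrow>\<^sub>C 'a"
  have T: "apply_bcontfun (T u) t = J (apply_bcontfun u) (clamp (-\<delta>) \<delta> t)" for u t
  proof -
    have "continuous_on (cbox (-\<delta>) \<delta>) (J (apply_bcontfun u))"
      using J_cont by simp
    then have "(\<lambda>t. J (apply_bcontfun u) (clamp (-\<delta>) \<delta> t)) \<in> bcontfun"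
      unfolding bcontfun_def
      using clamp_continuous_on[of "-\<delta>" \<delta>] clamp_bounded[of _ "-\<delta>" \<delta>]
        compact_continuous_image[OF _ compact_cbox] compact_imp_bounded by blast
    then show ?thesis by (simp add: T_def Bcontfun_inverse)
  qed
  have clamp: "clamp (-\<delta>) \<delta> t \<in> {-\<delta>..\<delta>}" for t
    using clamp_in_interval[of "-\<delta>" \<delta> t] \<delta> by simp
  have int_bound: "norm (integral {-\<delta>..t} h) \<le> 2 * \<delta> * B"
    if "continuous_on {-\<delta>..t} h" "\<And>s. norm (h s) \<le> B" "t \<in> {-\<delta>..\<delta>}" for h :: "real \<Rightarrow> 'a" and t B
  proof -
    have "norm (integral {-\<delta>..t} h) \<le> B * (t - (-\<delta>))"
      using that by (intro integral_bound) auto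
    also have "\<dots> \<le> B * (2 * \<delta>)"
      using that norm_ge_zero[of "h 0"] order_trans[OF norm_ge_zero that(2)]
      by (intro mult_left_mono) auto
    finally show ?thesis by (simp add: algebra_simps)
  qed
  have "dist (T u) (T v) \<le> 1 / 2 * dist u v" for u v
  proof (rule dist_bound)
    fix t
    let ?t = "clamp (-\<delta>) \<delta> t" and ?h = "\<lambda>s. g (apply_bcontfun u s) - g (apply_bcontfun v s)"
    have "continuous_on S ?h" for S
      by (intro continuous_intros g_cont) auto
    moreover have "norm (?h s) \<le> L * dist u v" for s
      using g_lip[of "apply_bcontfun u s" "apply_bcontfun v s"] dist_bounded[of u s v] L
      by (metis dist_norm mult_left_mono order_trans)
    ultimately have b: "norm (integral {-\<delta>..t} ?h) \<le> 2 * \<delta> * (L * dist u v)" if "t \<in> {-\<delta>..\<delta>}" for t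
      using that int_bound by blast
    have eq: "J (apply_bcontfun u) ?t - J (apply_bcontfun v) ?t = integral {-\<delta>..?t} ?h - integral {-\<delta>..0} ?h"
      unfolding J_def by (subst (1 2) integral_diff) (auto intro: int)
    have "norm (J (apply_bcontfun u) ?t - J (apply_bcontfun v) ?t)
        \<le> 2 * \<delta> * (L * dist u v) + 2 * \<delta> * (L * dist u v)"
      unfolding eq by (rule order_trans[OF norm_triangle_ineq4 add_mono]) (use b clamp \<delta> in auto)
    then have "dist (apply_bcontfun (T u) t) (apply_bcontfun (T v) t)
        \<le> 2 * \<delta> * (L * dist u v) + 2 * \<delta> * (L * dist u v)"
      using T by (metis dist_norm)
    also have "\<dots> = (4 * \<delta> * L) * dist u v"
      by (simp add: algebra_simps)
    also have "\<dots> \<le> 1 / 2 * dist u v"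
      using \<delta>L by (rule mult_right_mono) simp
    finally show "dist (apply_bcontfun (T u) t) (apply_bcontfun (T v) t) \<le> 1 / 2 * dist u v" .
  qed
  then obtain u where "T u = u"
    using banach_fix_type[of "1 / 2" T] by auto
  define z where "z = apply_bcontfun u"
  have z: "z t = J z t" if "t \<in> {-\<delta>..\<delta>}" for t
    using T[of u t] \<open>T u = u\<close> that by (simp add: z_def)
  have z_cont: "continuous_on S z" for S
    by (simp add: z_def)
  \<comment> \<open>The solution stays in the ball, where the projection is the identity, so it
    solves the equation for \<open>f\<close> and not only for \<open>g\<close>.\<close>
  have ball: "z t \<in> cball z\<^sub>0 r" if "t \<in> {-\<delta>..\<delta>}" for t
  proof -
    have "norm (integral {-\<delta>..t} (\<lambda>s. g (z s))) \<le> 2 * \<delta> * M" if "t \<in> {-\<delta>..\<delta>}" for t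
      by (rule int_bound[OF g_cont[OF z_cont] g_bound that])
    then have "norm (integral {-\<delta>..t} (\<lambda>s. g (z s)) - integral {-\<delta>..0} (\<lambda>s. g (z s))) \<le> 2 * \<delta> * M + 2 * \<delta> * M"
      by (intro order_trans[OF norm_triangle_ineq4 add_mono]) (use that \<delta> in auto)
    then show ?thesis
      using z[OF that] \<delta>M norm_minus_commute[of z\<^sub>0 "z t"]
      by (simp add: J_def dist_norm mult.commute mult.left_commute)
  qed
  have "(z has_vector_derivative f (z t)) (at t)" if t: "t \<in> {-\<delta><..<\<delta>}" for t
  proof -
    have "((\<lambda>t. integral {-\<delta>..t} (\<lambda>s. g (z s))) has_vector_derivative g (z t)) (at t within {-\<delta>..\<delta>})"
      using t by (intro integral_has_vector_derivative g_cont z_cont) auto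
    then have "((\<lambda>t. integral {-\<delta>..t} (\<lambda>s. g (z s))) has_vector_derivative g (z t)) (at t)"
      using t by (simp add: at_within_Icc_at)
    then have "(J z has_vector_derivative g (z t)) (at t)"
      unfolding J_def by (auto intro!: derivative_eq_intros)
    moreover have "g (z t) = f (z t)"
      using ball[of t] t by (simp add: g_def closest_point_self)
    ultimately have "(J z has_vector_derivative f (z t)) (at t)"
      by simp
    moreover have "J z s = z s" if "s \<in> {-\<delta><..<\<delta>}" for s
      using z[of s] that by simp
    ultimately show ?thesis
      using t has_vector_derivative_transform_within_open[OF _ open_greaterThanLessThan] by blast
  qed
  moreover have "z 0 = z\<^sub>0"
    using z[of 0] \<delta> by (simp add: J_def)
  ultimately show thesis
    using that[of \<delta> z] \<delta> ball by auto
qed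

section \<open>Lipschitz estimates and local existence of geodesics\<close>

lemma lipschitz_on_sum:
  assumes "\<And>i. i \<in> I \<Longrightarrow> \<exists>L. L-lipschitz_on S (\<lambda>z. f i z)"
  shows "\<exists>L. L-lipschitz_on S (\<lambda>z. \<Sum>i\<in>I. (f i z :: 'b::real_normed_vector))"
  using assms
proof (induction I rule: infinite_finite_induct)
  case (insert i I)
  then obtain L L' where "L-lipschitz_on S (f i)" "L'-lipschitz_on S (\<lambda>z. \<Sum>i\<in>I. f i z)"
    by blast
  from lipschitz_on_add[OF this] insert show ?case by auto
qed (auto intro!: exI[of _ 0] lipschitz_onI)

context slit_domain
begin

text \<open>Compactness bounds the partial derivatives, hence the operator norm of the derivative;
  convexity then gives the mean value inequality.\<close>

lemma smooth_lipschitz: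
  assumes A: "smooth A" and S: "compact S" "convex S" "S \<subseteq> \<Omega> \<times> (UNIV - {0})"
  shows "\<exists>L. L-lipschitz_on S (\<lambda>(x, y). A x y)"
proof -
  let ?f = "\<lambda>(x, y). A x y"
  have D: "(?f has_derivative frechet_derivative ?f (at z)) (at z)" if "z \<in> S" for z
  proof -
    have "?f differentiable (at (fst z, snd z))"
      using that S(3) by (intro smooth_differentiable[OF A]) auto
    then show ?thesis by (simp add: frechet_derivative_works)
  qed
  define b where "b = (\<lambda>z. (\<Sum>k\<in>UNIV. \<bar>pdx k A (fst z) (snd z)\<bar>) + (\<Sum>k\<in>UNIV. \<bar>pdy k A (fst z) (snd z)\<bar>))"
  have "continuous_on S b"
  proof -
    have "continuous_on S (\<lambda>z. B (fst z) (snd z))" if "smooth B" for B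
      using smooth_isCont[OF that] S(3)
      by (intro continuous_at_imp_continuous_on) (auto simp: case_prod_unfold)
    then show ?thesis
      unfolding b_def by (intro continuous_intros) (auto intro: smooth_intros A)
  qed
  then have "bounded (b ` S)"
    using S(1) compact_continuous_image compact_imp_bounded by blast
  then obtain B where B: "\<And>z. z \<in> S \<Longrightarrow> \<bar>b z\<bar> \<le> B"
    by (auto simp: bounded_iff)
  \<comment> \<open>A Lipschitz constant has to be nonnegative, and \<open>B\<close> may be negative
    when \<open>S\<close> is empty.\<close>
  have "onorm (frechet_derivative ?f (at z)) \<le> max B 0" if z: "z \<in> S" for z
  proof (rule onorm_bound)
    fix h :: "(real^'n) \<times> (real^'n)"
    obtain x y where xy: "z = (x, y)" by fastforce
    obtain u v where uv: "h = (u, v)" by fastforce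
    have diff: "?f differentiable (at (x, y))"
      using D[OF z] xy differentiable_def by blast
    have uh: "\<bar>u $ k\<bar> \<le> norm h" "\<bar>v $ k\<bar> \<le> norm h" for k
      using component_le_norm_cart[of u k] component_le_norm_cart[of v k] norm_fst_le[of u v] norm_snd_le[of v u] uv
      by auto
    have lin: "linear (frechet_derivative ?f (at z))"
      using D[OF z] has_derivative_linear by blast
    have "frechet_derivative ?f (at z) h = (\<Sum>k\<in>UNIV. u $ k * pdx k A x y) + (\<Sum>k\<in>UNIV. v $ k * pdy k A x y)"
      unfolding uv pair_decomp[of u v] linear_add[OF lin] linear_sum[OF lin] linear_cmul[OF lin] o_def
      using pdx_frechet[OF diff] pdy_frechet[OF diff] xy by simp
    also have "norm \<dots> \<le> (\<Sum>k\<in>UNIV. norm h * \<bar>pdx k A x y\<bar>) + (\<Sum>k\<in>UNIV. norm h * \<bar>pdy k A x y\<bar>)"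
      by (intro norm_triangle_mono sum_norm_le) (auto simp: abs_mult intro!: mult_right_mono uh)
    also have "\<dots> = b z * norm h"
      by (simp add: b_def xy sum_distrib_left algebra_simps)
    also have "\<dots> \<le> max B 0 * norm h"
      using B[OF z] by (intro mult_right_mono) auto
    finally show "norm (frechet_derivative ?f (at z) h) \<le> max B 0 * norm h" .
  qed simp
  then have "norm (?f z - ?f w) \<le> max B 0 * norm (z - w)" if "z \<in> S" "w \<in> S" for z w
    using that by (intro differentiable_bound[OF S(2)]) (auto intro: has_derivative_at_withinI D)
  then show ?thesis
    by (intro exI[of _ "max B 0"] lipschitz_onI) (auto simp: dist_norm)
qed

text \<open>The second order equation is a first order system for \<open>(\<gamma>, v)\<close>.
  \<open>picard_lindelof\<close> keeps the solution in a closed ball inside the slit bundle, so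
  \<open>v\<close> does not vanish.\<close>

lemma geodesic_flow_exists:
  fixes G :: "'n \<Rightarrow> real^'n \<Rightarrow> real^'n \<Rightarrow> real"
  assumes G: "\<And>i. smooth (G i)" and xy: "x \<in> \<Omega>" "y \<noteq> 0"
  obtains \<delta> \<gamma> v where "\<delta> > 0" "\<gamma> 0 = x" "v 0 = y"
    "\<And>t. t \<in> {-\<delta><..<\<delta>} \<Longrightarrow> \<gamma> t \<in> \<Omega> \<and> v t \<noteq> 0 \<and> (\<gamma> has_vector_derivative v t) (at t) \<and>
      (v has_vector_derivative (\<chi> i. - 2 * G i (\<gamma> t) (v t))) (at t)"
proof -
  obtain r where r: "r > 0" "cball (x, y) r \<subseteq> \<Omega> \<times> (UNIV - {0})"
    using open_slit xy open_contains_cball by (metis Diff_iff SigmaI UNIV_I singletonD)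
  let ?K = "cball (x, y) r"
  define f where "f z = (snd z, \<chi> i. - 2 * G i (fst z) (snd z))" for z
  have eq: "(\<lambda>z. (snd z, 0) + (\<Sum>i\<in>UNIV. (0, (- 2 * G i (fst z) (snd z)) *\<^sub>R axis i 1))) = f"
    by (auto simp: f_def prod_eq_iff fst_sum snd_sum vec_eq_iff axis_def if_distrib fun_eq_iff cong: if_cong)
  have "\<exists>L. L-lipschitz_on ?K (\<lambda>z. (0 :: real^'n, (- 2 * G i (fst z) (snd z)) *\<^sub>R axis i (1::real)))" for i
  proof -
    obtain L where L: "L-lipschitz_on ?K (\<lambda>(x, y). G i x y)"
      using smooth_lipschitz[OF G _ _ r(2)] by auto
    have dist: "dist (0 :: real^'n, a *\<^sub>R axis i (1::real)) (0, b *\<^sub>R axis i 1) = \<bar>a - b\<bar>" for a b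
      by (simp add: dist_Pair_Pair dist_norm flip: scaleR_diff_left)
    have "\<bar>G i (fst z) (snd z) - G i (fst w) (snd w)\<bar> \<le> L * dist z w" if "z \<in> ?K" "w \<in> ?K" for z w
      using lipschitz_onD[OF L that] by (simp add: dist_norm case_prod_unfold)
    then have "(2 * L)-lipschitz_on ?K (\<lambda>z. (0 :: real^'n, (- 2 * G i (fst z) (snd z)) *\<^sub>R axis i (1::real)))"
      using lipschitz_on_nonneg[OF L] unfolding lipschitz_on_def dist by fastforce
    then show ?thesis by blast
  qed
  then obtain L where "L-lipschitz_on ?K (\<lambda>z. \<Sum>i\<in>UNIV. (0 :: real^'n, (- 2 * G i (fst z) (snd z)) *\<^sub>R axis i (1::real)))"
    using lipschitz_on_sum[of UNIV ?K "\<lambda>i z. (0 :: real^'n, (- 2 * G i (fst z) (snd z)) *\<^sub>R axis i (1::real))"] by blast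
  moreover have "1-lipschitz_on ?K (\<lambda>z. (snd z, 0 :: real^'n))"
    by (intro lipschitz_onI) (auto simp: dist_Pair_Pair dist_snd_le)
  ultimately have "(1 + L)-lipschitz_on ?K f"
    unfolding eq[symmetric] using lipschitz_on_add by blast
  with r(1) obtain \<delta> z where z: "\<delta> > 0" "z 0 = (x, y)"
    "\<And>t. t \<in> {-\<delta><..<\<delta>} \<Longrightarrow> z t \<in> ?K \<and> (z has_vector_derivative f (z t)) (at t)"
    using picard_lindelof by metis
  have "fst (z t) \<in> \<Omega> \<and> snd (z t) \<noteq> 0
      \<and> ((\<lambda>t. fst (z t)) has_vector_derivative snd (z t)) (at t)
      \<and> ((\<lambda>t. snd (z t)) has_vector_derivative (\<chi> i. - 2 * G i (fst (z t)) (snd (z t)))) (at t)"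
    if "t \<in> {-\<delta><..<\<delta>}" for t
  proof -
    have "z t \<in> \<Omega> \<times> (UNIV - {0})" and d: "(z has_vector_derivative f (z t)) (at t)"
      using z(3)[OF that] r(2) by auto
    then show ?thesis
      using bounded_linear.has_vector_derivative[OF bounded_linear_fst d]
        bounded_linear.has_vector_derivative[OF bounded_linear_snd d]
      by (auto simp: f_def)
  qed
  then show thesis
    using z by (intro that[of \<delta> "\<lambda>t. fst (z t)" "\<lambda>t. snd (z t)"]) auto
qed

end

section \<open>Projective flatness and flag curvature\<close>

text \<open>
  A vector \<open>u \<noteq> 0\<close> with \<open>w \<bullet> u = 0\<close> determines \<open>\<Xi>\<close>; then \<open>y + u\<close> and \<open>y + 2 u\<close> determine \<open>\<tau>\<close>.
  Assuming only the two contractions of \<open>g\<close> with \<open>y\<close> instead of its symmetry avoids any interchange of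
  partial derivatives, since both follow from Euler's identity.
\<close>

lemma flag_quotient_eq_iff:
  fixes g :: "real^'n^'n" and y w \<tau> :: "real^'n" and \<Xi> :: real
  assumes dim: "CARD('n) \<ge> 2" and y: "y \<noteq> 0"
    and pos: "\<And>v. v \<noteq> 0 \<Longrightarrow> 0 < v \<bullet> (g *v v)"
    and gy: "g *v y = w" "\<And>u. y \<bullet> (g *v u) = w \<bullet> u"
  shows "(\<forall>u. u \<notin> span {y} \<longrightarrow>
      (\<Xi> * (u \<bullet> (g *v u)) + (\<tau> \<bullet> u) * (w \<bullet> u)) / ((y \<bullet> w) * (u \<bullet> (g *v u)) - (w \<bullet> u)\<^sup>2) = - 1)
    \<longleftrightarrow> \<Xi> = - (y \<bullet> w) \<and> \<tau> = w" (is "?L \<longleftrightarrow> ?R")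
proof -
  define f where "f = y \<bullet> w"
  have f: "f > 0"
    using pos[OF y] gy(1) by (simp add: f_def)
  have w: "w \<bullet> (c *\<^sub>R y + u) = c * f + w \<bullet> u" for c u
    by (simp add: f_def inner_add_right inner_commute)
  have q: "(c *\<^sub>R y + u) \<bullet> (g *v (c *\<^sub>R y + u)) = c\<^sup>2 * f + 2 * c * (w \<bullet> u) + u \<bullet> (g *v u)" for c u
    by (simp add: f_def matrix_vector_right_distrib matrix_vector_mult_scaleR gy inner_add_right
        inner_add_left inner_commute power2_eq_square algebra_simps)
  have nspan: "c *\<^sub>R y + u \<notin> span {y}" if "w \<bullet> u = 0" "u \<noteq> 0" for c u
  proof
    assume "c *\<^sub>R y + u \<in> span {y}"
    then obtain d where "c *\<^sub>R y + u = d *\<^sub>R y"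
      by (auto simp: span_singleton)
    then have u: "u = (d - c) *\<^sub>R y"
      by (simp add: algebra_simps)
    then have "(d - c) * f = 0"
      using that by (simp add: f_def inner_commute)
    then show False
      using f u that by simp
  qed
  have dec: "\<exists>c v. u = c *\<^sub>R y + v \<and> w \<bullet> v = 0" for u
    using f w[of 0] by (intro exI[of _ "(w \<bullet> u) / f"] exI[of _ "u - ((w \<bullet> u) / f) *\<^sub>R y"])
      (simp add: inner_diff_right f_def inner_commute)
  \<comment> \<open>The terms in \<open>c\<close> cancel: the denominator depends only on the
    component \<open>v\<close> of \<open>u\<close> in the kernel of \<open>w\<close>, and positivity
    of \<open>g\<close> makes it positive for \<open>v \<noteq> 0\<close>.\<close>
  have den: "f * (u \<bullet> (g *v u)) - (w \<bullet> u)\<^sup>2 = f * (v \<bullet> (g *v v))"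
    if "u = c *\<^sub>R y + v" "w \<bullet> v = 0" for u v c
    unfolding that(1) w q using that(2) by (simp add: power2_eq_square algebra_simps)
  show ?thesis
  proof
    assume L: ?L
    obtain u where u: "u \<noteq> 0" "w \<bullet> u = 0"
      using orthogonal_to_vector_exists[of w] dim by (auto simp: orthogonal_def)
    have *: "\<Xi> * ((c *\<^sub>R y + v) \<bullet> (g *v (c *\<^sub>R y + v))) + (\<tau> \<bullet> (c *\<^sub>R y + v)) * (c * f) = - (f * (v \<bullet> (g *v v)))"
      if v: "v \<noteq> 0" "w \<bullet> v = 0" for c v
    proof -
      have "f * (v \<bullet> (g *v v)) > 0"
        using f pos v by simp
      moreover have "(\<Xi> * ((c *\<^sub>R y + v) \<bullet> (g *v (c *\<^sub>R y + v))) + (\<tau> \<bullet> (c *\<^sub>R y + v)) * (c * f))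
          / (f * (v \<bullet> (g *v v))) = - 1"
        using L[rule_format, OF nspan[OF v(2,1), of c]]
        unfolding f_def[symmetric] den[OF refl v(2)] by (simp only: w v(2) add_0_right)
      moreover have "N = - D" if "D > 0" "N / D = - 1" for N D :: real
        using that by (simp add: field_simps)
      ultimately show ?thesis by blast
    qed
    have \<Xi>: "\<Xi> = - f"
      using *[OF u, of 0] pos[OF u(1)] mult_right_cancel[of "u \<bullet> (g *v u)" \<Xi> "- f"] by simp
    have \<tau>: "\<tau> \<bullet> (y + v) = f" if v: "v \<noteq> 0" "w \<bullet> v = 0" for v
    proof -
      have "\<tau> \<bullet> (y + v) * f = f * f"
        using *[OF v, of 1] unfolding q v(2) \<Xi> by (simp add: algebra_simps)
      then show ?thesis using f by simp
    qed
    have zero: "\<tau> \<bullet> v = 0" if "w \<bullet> v = 0" for v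
    proof (cases "v = 0")
      case False
      then show ?thesis
        using \<tau>[of v] \<tau>[of "2 *\<^sub>R v"] that by (simp add: inner_add_right)
    qed simp
    have "\<tau> \<bullet> y = f"
      using \<tau>[OF u] zero[OF u(2)] by (simp add: inner_add_right)
    then have "\<tau> \<bullet> u = w \<bullet> u" for u
      using dec[of u] zero w by (auto simp: inner_add_right)
    then show ?R
      using \<Xi> vector_eq_rdot[of \<tau> w] by (auto simp: f_def inner_commute)
  next
    assume R: ?R
    show ?L
    proof (intro allI impI)
      fix u
      assume u: "u \<notin> span {y}"
      obtain c v where v: "u = c *\<^sub>R y + v" "w \<bullet> v = 0"
        using dec by blast
      have "v \<noteq> 0"
        using u v by (auto simp: span_base span_mul)
      then have "f * (u \<bullet> (g *v u)) - (w \<bullet> u)\<^sup>2 > 0"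
        using den[OF v] f pos by simp
      then show "(\<Xi> * (u \<bullet> (g *v u)) + (\<tau> \<bullet> u) * (w \<bullet> u)) / ((y \<bullet> w) * (u \<bullet> (g *v u)) - (w \<bullet> u)\<^sup>2) = - 1"
        using R by (simp add: f_def[symmetric] field_simps power2_eq_square)
    qed
  qed
qed

section \<open>Geodesic coefficients, projective factor and curvature of a Finsler metric\<close>

locale finsler_domain = slit_domain \<Omega> for \<Omega> :: "(real^'n::finite) set" +
  fixes F :: "real^'n \<Rightarrow> real^'n \<Rightarrow> real"
  assumes finsler: "finsler_metric \<Omega> F"
begin

abbreviation L :: "real^'n \<Rightarrow> real^'n \<Rightarrow> real" where
  "L x y \<equiv> (F x y)\<^sup>2"

abbreviation G :: "'n \<Rightarrow> real^'n \<Rightarrow> real^'n \<Rightarrow> real" where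
  "G \<equiv> geodesic_coeff F"

text \<open>The Legendre transform of \<open>y\<close>, that is, the fibre derivative of
  \<open>F^2 / 2\<close>.\<close>

definition dual :: "real^'n \<Rightarrow> real^'n \<Rightarrow> real^'n" where
  "dual x y = (\<chi> i. F x y * pdy i F x y)"

text \<open>Four times the geodesic coefficients with the index lowered by \<open>g\<close>; working
  with it avoids the inverse matrix.\<close>

definition spray_covector :: "real^'n \<Rightarrow> real^'n \<Rightarrow> real^'n" where
  "spray_covector x y = (\<chi> l. (\<Sum>m\<in>UNIV. pdy l (pdx m L) x y * y $ m) - pdx l L x y)"

lemma F_smooth: "smooth F"
  using finsler by (simp add: finsler_metric_def smooth_def)

lemma F_homogeneous: "homogeneous 1 F"
  using finsler by (simp add: finsler_metric_def homogeneous_def)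

lemma F_pos: "x \<in> \<Omega> \<Longrightarrow> y \<noteq> 0 \<Longrightarrow> F x y > 0"
  using finsler unfolding finsler_metric_def less_le by metis

lemma L_smooth: "smooth L"
  by (intro smooth_intros F_smooth)

lemma L_homogeneous: "homogeneous 2 L"
  using F_homogeneous by (simp add: homogeneous_def power_mult_distrib)

lemma fund_tensor_pos: "x \<in> \<Omega> \<Longrightarrow> y \<noteq> 0 \<Longrightarrow> v \<noteq> 0 \<Longrightarrow> 0 < v \<bullet> (fund_tensor F x y *v v)"
  using finsler by (auto simp: finsler_metric_def)

lemma fund_tensor_eq:
  assumes "x \<in> \<Omega>" "y \<noteq> 0"
  shows "fund_tensor F x y $ i $ j = pdy j (\<lambda>x y. F x y * pdy i F x y) x y"
proof -
  have e: "pdy i (\<lambda>x y. L x y / 2) x y = F x y * pdy i F x y" if "x \<in> \<Omega>" "y \<noteq> 0" for x y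
  proof -
    have "pdy i (\<lambda>x y. 1 / 2 * L x y) x y = 0 * L x y + 1 / 2 * (2 * F x y * pdy i F x y)"
      unfolding pdy_mult[OF smooth_const L_smooth that] pdy_power2[OF F_smooth that] pdy_const ..
    then show ?thesis by simp
  qed
  have "pdy j (pdy i (\<lambda>x y. L x y / 2)) x y = pdy j (\<lambda>x y. F x y * pdy i F x y) x y"
    by (rule pdy_cong) (use e assms in auto)
  then show ?thesis
    by (simp add: fund_tensor_def)
qed

lemma fund_tensor_smooth: "smooth (\<lambda>x y. fund_tensor F x y $ i $ j)"
  by (rule smooth_cong[OF _ fund_tensor_eq[symmetric]]) (auto intro!: smooth_intros F_smooth)

text \<open>The right contraction is Euler's identity for the degree one functions
  \<open>F x y * pdy i F x y\<close>. The left one arises by differentiating their own contraction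
  with \<open>y\<close>, which is \<open>F^2\<close>.\<close>

lemma
  assumes xy: "x \<in> \<Omega>" "y \<noteq> 0"
  shows fund_tensor_contract_right: "fund_tensor F x y *v y = dual x y"
    and fund_tensor_contract_left: "y \<bullet> (fund_tensor F x y *v u) = dual x y \<bullet> u"
    and inner_dual: "y \<bullet> dual x y = L x y"
proof -
  have A: "smooth (\<lambda>x y. F x y * pdy i F x y)" for i
    by (intro smooth_intros F_smooth)
  have "homogeneous 1 (\<lambda>x y. F x y * pdy i F x y)" for i
    using F_homogeneous homogeneous_pdy[of F 0] F_smooth by (simp add: homogeneous_def)
  from euler[OF A this xy] show "fund_tensor F x y *v y = dual x y"
    by (simp add: vec_eq_iff matrix_vector_mult_def fund_tensor_eq[OF xy] dual_def)
  have "(\<Sum>m\<in>UNIV. pdy m F x y * y $ m) = F x y" if "x \<in> \<Omega>" "y \<noteq> 0" for x y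
    using euler[OF F_smooth F_homogeneous that] by simp
  then have e: "(\<Sum>m\<in>UNIV. F x y * pdy m F x y * y $ m) = L x y" if "x \<in> \<Omega>" "y \<noteq> 0" for x y
    using that by (simp add: mult.assoc sum_distrib_left[symmetric] power2_eq_square)
  then show "y \<bullet> dual x y = L x y"
    using xy by (simp add: dual_def inner_vec_def mult.commute)
  have "(\<Sum>i\<in>UNIV. fund_tensor F x y $ i $ j * y $ i) = dual x y $ j" for j
  proof -
    have "pdy j (\<lambda>x y. \<Sum>m\<in>UNIV. F x y * pdy m F x y * y $ m) x y = pdy j L x y"
      by (rule pdy_cong) (use e xy in auto)
    then show ?thesis
      using pdy_contract[where A = "\<lambda>i x y. F x y * pdy i F x y" and l = j, OF A xy]
        pdy_power2[OF F_smooth xy, where k = j]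
      by (simp add: fund_tensor_eq[OF xy] dual_def)
  qed
  moreover have "y \<bullet> (fund_tensor F x y *v u) = (\<Sum>j\<in>UNIV. (\<Sum>i\<in>UNIV. fund_tensor F x y $ i $ j * y $ i) * u $ j)"
    unfolding inner_vec_def matrix_vector_mult_def
    by (simp add: sum_distrib_left sum_distrib_right) (subst sum.swap, simp add: mult_ac)
  ultimately show "y \<bullet> (fund_tensor F x y *v u) = dual x y \<bullet> u"
    by (simp add: inner_vec_def)
qed

lemma fund_tensor_invertible:
  assumes "x \<in> \<Omega>" "y \<noteq> 0"
  shows "invertible (fund_tensor F x y)"
  unfolding invertible_left_inverse matrix_left_invertible_ker
  using fund_tensor_pos[OF assms] by (metis inner_zero_right less_irrefl)

lemma fund_tensor_mult_geodesic_coeff: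
  assumes xy: "x \<in> \<Omega>" "y \<noteq> 0"
  shows "fund_tensor F x y *v (\<chi> i. G i x y) = (1 / 4) *\<^sub>R spray_covector x y"
proof -
  have "(\<chi> i. G i x y) = (1 / 4) *\<^sub>R (matrix_inv (fund_tensor F x y) *v spray_covector x y)"
    by (simp add: vec_eq_iff geodesic_coeff_def spray_covector_def matrix_vector_mult_def)
  moreover have "fund_tensor F x y ** matrix_inv (fund_tensor F x y) = mat 1"
    using someI_ex[OF fund_tensor_invertible[OF xy, unfolded invertible_def]] by (simp add: matrix_inv_def)
  ultimately show ?thesis
    by (simp add: matrix_vector_mult_scaleR matrix_vector_mul_assoc)
qed

lemma spray_covector_eq:
  assumes "x \<in> \<Omega>" "y \<noteq> 0"
  shows "spray_covector x y $ l = pdy l (\<lambda>x y. \<Sum>m\<in>UNIV. pdx m L x y * y $ m) x y - 2 * pdx l L x y"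
  using pdy_contract[where A = "\<lambda>m. pdx m L", OF smooth_pdx[OF L_smooth] assms] by (simp add: spray_covector_def)

text \<open>Applying the invertible \<open>g\<close> to both sides removes
  \<open>matrix_inv\<close>, since \<open>g\<close> maps \<open>y\<close> to
  \<open>dual x y\<close>.\<close>

lemma geodesic_coeff_parallel_iff:
  assumes xy: "x \<in> \<Omega>" "y \<noteq> 0"
  shows "(\<forall>i. G i x y = c * y $ i) \<longleftrightarrow> (\<forall>l. spray_covector x y $ l = 4 * c * F x y * pdy l F x y)"
proof -
  let ?g = "fund_tensor F x y"
  obtain g' where g': "g' ** ?g = mat 1"
    using fund_tensor_invertible[OF xy] invertible_left_inverse by blast
  have "(\<forall>i. G i x y = c * y $ i) \<longleftrightarrow> (\<chi> i. G i x y) = c *\<^sub>R y"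
    by (simp add: vec_eq_iff)
  also have "\<dots> \<longleftrightarrow> ?g *v (\<chi> i. G i x y) = ?g *v (c *\<^sub>R y)"
    using g' by (metis matrix_vector_mul_assoc matrix_vector_mul_lid)
  also have "\<dots> \<longleftrightarrow> (\<forall>l. spray_covector x y $ l = 4 * c * F x y * pdy l F x y)"
    unfolding fund_tensor_mult_geodesic_coeff[OF xy] matrix_vector_mult_scaleR fund_tensor_contract_right[OF xy]
    by (auto simp: vec_eq_iff dual_def field_simps)
  finally show ?thesis .
qed

text \<open>By Cramer's rule \<open>G i\<close> is a quotient of determinants with smooth entries,
  so the matrix inverse need not be differentiated.\<close>

lemma geodesic_coeff_smooth: "smooth (G i)"
proof -
  let ?b = "\<lambda>x y. (1 / 4) *\<^sub>R spray_covector x y"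
  let ?M = "\<lambda>x y. \<chi> j k. if k = i then ?b x y $ j else fund_tensor F x y $ j $ k"
  have nz: "det (fund_tensor F x y) \<noteq> 0" if "x \<in> \<Omega>" "y \<noteq> 0" for x y
    using fund_tensor_invertible[OF that] invertible_det_nz by blast
  have "smooth (\<lambda>x y. spray_covector x y $ j)" for j
    unfolding spray_covector_def by (simp, intro smooth_intros L_smooth)
  then have "smooth (\<lambda>x y. ?b x y $ j)" for j
    by (simp, intro smooth_divide smooth_const) auto
  then have "smooth (\<lambda>x y. ?M x y $ j $ k)" for j k
    using fund_tensor_smooth by (cases "k = i") simp_all
  then have "smooth (\<lambda>x y. det (?M x y) / det (fund_tensor F x y))"
    using nz by (intro smooth_divide smooth_det fund_tensor_smooth) auto
  then show ?thesis
  proof (rule smooth_cong)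
    fix x y :: "real^'n"
    assume xy: "x \<in> \<Omega>" "y \<noteq> 0"
    have "(\<chi> i. G i x y) = (\<chi> i. det (\<chi> j k. if k = i then ?b x y $ j else fund_tensor F x y $ j $ k) / det (fund_tensor F x y))"
      using fund_tensor_mult_geodesic_coeff[OF xy] cramer[OF nz[OF xy]] by blast
    then show "det (?M x y) / det (fund_tensor F x y) = G i x y"
      by (simp add: vec_eq_iff)
  qed
qed

text \<open>The hypothesis gives a factor at each point separately, with no regularity. Contraction
  with \<open>y\<close> identifies it with the smooth quotient \<open>S / (4 L)\<close>;
  differentiating \<open>S = 4 P L\<close> along the fibre and comparing with the spray covector
  then gives the equation for \<open>pdx l F\<close>.\<close>

lemma projective_factor:
  assumes "\<And>x y. x \<in> \<Omega> \<Longrightarrow> y \<noteq> 0 \<Longrightarrow> \<exists>c. \<forall>i. G i x y = c * y $ i"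
  obtains P where "smooth P" "homogeneous 1 P"
    "\<And>x y i. x \<in> \<Omega> \<Longrightarrow> y \<noteq> 0 \<Longrightarrow> G i x y = P x y * y $ i"
    "\<And>x y l. x \<in> \<Omega> \<Longrightarrow> y \<noteq> 0 \<Longrightarrow> pdx l F x y = pdy l P x y * F x y + P x y * pdy l F x y"
    "\<And>x y. x \<in> \<Omega> \<Longrightarrow> y \<noteq> 0 \<Longrightarrow> P x y = (\<Sum>m\<in>UNIV. pdx m F x y * y $ m) / (2 * F x y)"
proof -
  define S where "S x y = (\<Sum>m\<in>UNIV. pdx m L x y * y $ m)" for x y
  define P where "P x y = S x y / (4 * L x y)" for x y
  have S_smooth: "smooth S"
    unfolding S_def by (intro smooth_intros L_smooth)
  have S_hom: "homogeneous 3 S"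
    using homogeneous_pdx[OF L_smooth L_homogeneous]
    by (simp add: homogeneous_def S_def sum_distrib_left power2_eq_square power3_eq_cube mult_ac)
  have P_smooth: "smooth P"
    unfolding P_def by (intro smooth_divide smooth_intros S_smooth L_smooth) (use F_pos in fastforce)
  have P_hom: "homogeneous 1 P"
    unfolding homogeneous_def
  proof (intro ballI allI impI)
    fix x y :: "real^'n" and t :: real
    assume *: "x \<in> \<Omega>" "y \<noteq> 0" "0 < t"
    then have "S x (t *\<^sub>R y) = t ^ 3 * S x y" "L x (t *\<^sub>R y) = t\<^sup>2 * L x y"
      using S_hom L_homogeneous by (auto simp: homogeneous_def)
    then show "P x (t *\<^sub>R y) = t ^ 1 * P x y"
      using * by (simp add: P_def power2_eq_square power3_eq_cube)
  qed
  have fac: "S x y = 4 * P x y * L x y \<and> (\<forall>i. G i x y = P x y * y $ i)" if xy: "x \<in> \<Omega>" "y \<noteq> 0" for x y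
  proof -
    obtain c where c: "\<forall>i. G i x y = c * y $ i"
      using assms[OF xy] by blast
    then have w: "pdy l S x y - 2 * pdx l L x y = 4 * c * F x y * pdy l F x y" for l
      using geodesic_coeff_parallel_iff[OF xy] spray_covector_eq[OF xy] unfolding S_def by metis
    \<comment> \<open>Euler's identity for \<open>S\<close>, of degree 3, leaves
      \<open>3 S - 2 S = S\<close>, which determines \<open>c\<close>.\<close>
    have "4 * c * L x y = (\<Sum>l\<in>UNIV. (4 * c * F x y * pdy l F x y) * y $ l)"
      unfolding inner_dual[OF xy, symmetric] by (simp add: dual_def inner_vec_def sum_distrib_left mult_ac)
    also have "\<dots> = (\<Sum>l\<in>UNIV. pdy l S x y * y $ l) - 2 * S x y"
      unfolding w[symmetric] by (simp add: S_def algebra_simps sum_subtractf sum_distrib_left)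
    also have "\<dots> = S x y"
      using euler[OF S_smooth S_hom xy] by simp
    finally have "S x y = 4 * c * L x y" by simp
    moreover from this have "P x y = c"
      using F_pos[OF xy] by (simp add: P_def)
    ultimately show ?thesis using c by simp
  qed
  have "pdx l F x y = pdy l P x y * F x y + P x y * pdy l F x y" if xy: "x \<in> \<Omega>" "y \<noteq> 0" for x y l
  proof -
    have PL: "smooth (\<lambda>x y. P x y * L x y)" "smooth (\<lambda>x y. 4 :: real)"
      by (intro smooth_intros P_smooth L_smooth)+
    have "pdy l S x y = pdy l (\<lambda>x y. 4 * (P x y * L x y)) x y"
      using fac by (intro pdy_cong xy) auto
    also have "\<dots> = 4 * (pdy l P x y * L x y + P x y * (2 * F x y * pdy l F x y))"
      by (simp add: pdy_mult[OF PL(2,1) xy] pdy_mult[OF P_smooth L_smooth xy] pdy_const pdy_power2[OF F_smooth xy])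
    finally have "pdy l S x y = 4 * (pdy l P x y * L x y + P x y * (2 * F x y * pdy l F x y))" .
    moreover have "pdy l S x y - 2 * pdx l L x y = 4 * P x y * F x y * pdy l F x y"
      using geodesic_coeff_parallel_iff[OF xy, of "P x y"] fac[OF xy] spray_covector_eq[OF xy] unfolding S_def by metis
    ultimately have "F x y * (pdy l P x y * F x y + P x y * pdy l F x y) = F x y * pdx l F x y"
      unfolding pdx_power2[OF F_smooth xy] by (simp add: power2_eq_square algebra_simps)
    then show ?thesis
      using F_pos[OF xy] by simp
  qed
  moreover have "P x y = (\<Sum>m\<in>UNIV. pdx m F x y * y $ m) / (2 * F x y)" if xy: "x \<in> \<Omega>" "y \<noteq> 0" for x y
    using F_pos[OF xy]
    unfolding P_def S_def pdx_power2[OF F_smooth xy] by (simp add: mult.assoc sum_distrib_left[symmetric] power2_eq_square)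
  ultimately show thesis
    using that P_smooth P_hom fac by blast
qed

text \<open>Contracting the equation with \<open>y\<close> recovers \<open>S = 4 P L\<close> by
  Euler. In the spray covector the terms with \<open>pdy l P\<close> then cancel and a multiple of
  \<open>dual\<close> remains.\<close>

lemma geodesic_coeff_eq_projective_factor:
  assumes P: "smooth P" "homogeneous 1 P"
    and F: "\<And>x y l. x \<in> \<Omega> \<Longrightarrow> y \<noteq> 0 \<Longrightarrow> pdx l F x y = pdy l P x y * F x y + P x y * pdy l F x y"
    and xy: "x \<in> \<Omega>" "y \<noteq> 0"
  shows "G i x y = P x y * y $ i"
proof -
  have S: "(\<Sum>m\<in>UNIV. pdx m L x y * y $ m) = 4 * (P x y * L x y)" if xy: "x \<in> \<Omega>" "y \<noteq> 0" for x y
  proof -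
    have "(\<Sum>m\<in>UNIV. pdx m L x y * y $ m)
        = 2 * F x y * (F x y * (\<Sum>m\<in>UNIV. pdy m P x y * y $ m) + P x y * (\<Sum>m\<in>UNIV. pdy m F x y * y $ m))"
      by (simp add: pdx_power2[OF F_smooth xy] F[OF xy] sum_distrib_left sum.distrib[symmetric] algebra_simps)
    then show ?thesis
      using euler[OF P xy] euler[OF F_smooth F_homogeneous xy] by (simp add: power2_eq_square)
  qed
  have PL: "smooth (\<lambda>x y. P x y * L x y)" "smooth (\<lambda>x y. 4 :: real)"
    by (intro smooth_intros P L_smooth)+
  have "pdy l (\<lambda>x y. \<Sum>m\<in>UNIV. pdx m L x y * y $ m) x y = pdy l (\<lambda>x y. 4 * (P x y * L x y)) x y" for l
    by (rule pdy_cong) (use S xy in auto)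
  moreover have "pdy l (\<lambda>x y. 4 * (P x y * L x y)) x y = 4 * (pdy l P x y * L x y + P x y * (2 * F x y * pdy l F x y))" for l
    by (simp add: pdy_mult[OF PL(2,1) xy] pdy_mult[OF P(1) L_smooth xy] pdy_const pdy_power2[OF F_smooth xy])
  ultimately have "pdy l (\<lambda>x y. \<Sum>m\<in>UNIV. pdx m L x y * y $ m) x y
      = 4 * (pdy l P x y * L x y + P x y * (2 * F x y * pdy l F x y))" for l
    by (simp only:)
  then have "spray_covector x y $ l = 4 * P x y * F x y * pdy l F x y" for l
    unfolding spray_covector_eq[OF xy] pdx_power2[OF F_smooth xy]
    by (simp add: F[OF xy] power2_eq_square[of "F x y"] algebra_simps)
  then show ?thesis
    using geodesic_coeff_parallel_iff[OF xy] by blast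
qed

text \<open>Substitution of \<open>P y\<close> into the curvature formula; every contracted fibre
  derivative of \<open>P\<close> is then evaluated by Euler's identity or expressed through
  \<open>Q\<close>.\<close>

lemma riemann_curvature_projective:
  assumes P: "smooth P" "homogeneous 1 P"
    and GP: "\<And>x y i. x \<in> \<Omega> \<Longrightarrow> y \<noteq> 0 \<Longrightarrow> G i x y = P x y * y $ i"
    and xy: "x \<in> \<Omega>" "y \<noteq> 0"
  defines "Q \<equiv> \<lambda>x y. \<Sum>j\<in>UNIV. pdx j P x y * y $ j"
  shows "riemann_curvature F i k x y = ((P x y)\<^sup>2 - Q x y) * (if i = k then 1 else 0)
    + (3 * pdx k P x y - pdy k Q x y - P x y * pdy k P x y) * y $ i"
proof -
  define d where "d i j = (if i = j then 1 else 0 :: real)" for i j :: 'n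
  have d: "(\<Sum>j\<in>UNIV. f j * d i j) = f i" "(\<Sum>j\<in>UNIV. f j * d j i) = f i" for f :: "'n \<Rightarrow> real" and i
    by (simp_all add: d_def if_distrib cong: if_cong)
  have Gx: "pdx k (G i) x y = pdx k P x y * y $ i" if xy: "x \<in> \<Omega>" "y \<noteq> 0" for i k x y
    using pdx_cong[OF GP xy] pdx_mult[OF P(1) smooth_coord xy] by (simp add: pdx_coord)
  have Gy: "pdy k (G i) x y = pdy k P x y * y $ i + P x y * d i k" if xy: "x \<in> \<Omega>" "y \<noteq> 0" for i k x y
    using pdy_cong[OF GP xy] pdy_mult[OF P(1) smooth_coord xy] by (simp add: pdy_coord d_def)
  have Gxy: "pdy k (pdx j (G i)) x y = pdy k (pdx j P) x y * y $ i + pdx j P x y * d i k" for i j k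
    using pdy_cong[OF Gx xy] pdy_mult[OF smooth_pdx[OF P(1)] smooth_coord xy] by (simp add: pdy_coord d_def)
  have Gyy: "pdy k (pdy j (G i)) x y = pdy k (pdy j P) x y * y $ i + pdy j P x y * d i k + pdy k P x y * d i j" for i j k
  proof -
    have s: "smooth (\<lambda>x y. pdy j P x y * y $ i)" "smooth (\<lambda>x y. P x y * d i j)"
      by (intro smooth_intros P)+
    have "pdy k (pdy j (G i)) x y = pdy k (\<lambda>x y. pdy j P x y * y $ i + P x y * d i j) x y"
      by (rule pdy_cong) (use Gy xy in auto)
    then show ?thesis
      unfolding pdy_add[OF s xy] pdy_mult[OF smooth_pdy[OF P(1)] smooth_coord xy]
        pdy_mult[OF P(1) smooth_const xy] pdy_coord pdy_const by (simp add: d_def)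
  qed
  have e: "(\<Sum>j\<in>UNIV. pdy j P x y * y $ j) = P x y" if "x \<in> \<Omega>" "y \<noteq> 0" for x y
    using euler[OF P that] by simp
  have T: "(\<Sum>j\<in>UNIV. pdy k (pdx j P) x y * y $ j) = pdy k Q x y - pdx k P x y"
    unfolding Q_def by (rule pdy_contract[OF smooth_pdx[OF P(1)] xy])
  \<comment> \<open>Fibre derivative of Euler's identity for \<open>P\<close>: the two first order
    terms cancel.\<close>
  have E: "(\<Sum>j\<in>UNIV. pdy k (pdy j P) x y * y $ j) = 0"
    using pdy_contract[OF smooth_pdy[OF P(1)] xy, of k] pdy_cong[OF e xy] by simp
  have 1: "(\<Sum>j\<in>UNIV. y $ j * pdy k (pdx j (G i)) x y) = (pdy k Q x y - pdx k P x y) * y $ i + Q x y * d i k"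
    unfolding Gxy T[symmetric] by (simp add: Q_def sum_distrib_left sum.distrib algebra_simps)
  have "(\<Sum>j\<in>UNIV. G j x y * pdy k (pdy j (G i)) x y)
      = P x y * ((\<Sum>j\<in>UNIV. pdy k (pdy j P) x y * y $ j) * y $ i
        + (\<Sum>j\<in>UNIV. pdy j P x y * y $ j) * d i k + pdy k P x y * (\<Sum>j\<in>UNIV. y $ j * d i j))"
    unfolding Gyy GP[OF xy]
    by (simp only: sum_distrib_right sum_distrib_left sum.distrib[symmetric] distrib_left distrib_right) (simp add: algebra_simps)
  then have 2: "(\<Sum>j\<in>UNIV. G j x y * pdy k (pdy j (G i)) x y) = P x y * (P x y * d i k + pdy k P x y * y $ i)"
    unfolding E e[OF xy] d by simp
  have "(\<Sum>j\<in>UNIV. pdy j (G i) x y * pdy k (G j) x y)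
      = (\<Sum>j\<in>UNIV. pdy j P x y * y $ j) * y $ i * pdy k P x y + P x y * y $ i * (\<Sum>j\<in>UNIV. pdy j P x y * d j k)
        + P x y * pdy k P x y * (\<Sum>j\<in>UNIV. y $ j * d i j) + P x y * P x y * (\<Sum>j\<in>UNIV. d i j * d j k)"
    unfolding Gy[OF xy]
    by (simp only: sum_distrib_right sum_distrib_left sum.distrib[symmetric] distrib_left distrib_right) (simp add: algebra_simps)
  then have 3: "(\<Sum>j\<in>UNIV. pdy j (G i) x y * pdy k (G j) x y) = 3 * P x y * pdy k P x y * y $ i + (P x y)\<^sup>2 * d i k"
    unfolding e[OF xy] d by (simp add: power2_eq_square)
  show ?thesis
    unfolding riemann_curvature_def Let_def 1 2 3 Gx[OF xy] d_def[symmetric]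
    by (simp add: algebra_simps power2_eq_square)
qed

text \<open>Once \<open>Q = P^2 + F^2\<close> is known, its fibre derivative turns the condition on
  \<open>\<tau>\<close> into three times the stated equation. Conversely, contracting that equation
  with \<open>y\<close> returns \<open>Q\<close> by Euler's identity.\<close>

lemma constant_flag_curvature_iff:
  assumes dim: "CARD('n) \<ge> 2"
    and P: "smooth P" "homogeneous 1 P"
    and GP: "\<And>x y i. x \<in> \<Omega> \<Longrightarrow> y \<noteq> 0 \<Longrightarrow> G i x y = P x y * y $ i"
  shows "constant_flag_curvature \<Omega> F (-1) \<longleftrightarrow>
    (\<forall>x\<in>\<Omega>. \<forall>y k. y \<noteq> 0 \<longrightarrow> pdx k P x y = P x y * pdy k P x y + F x y * pdy k F x y)"
proof -
  define Q where "Q = (\<lambda>x y. \<Sum>j\<in>UNIV. pdx j P x y * y $ j)"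
  define \<Xi> where "\<Xi> x y = (P x y)\<^sup>2 - Q x y" for x y
  define \<tau> where "\<tau> x y = (\<chi> k. 3 * pdx k P x y - pdy k Q x y - P x y * pdy k P x y)" for x y
  have flag: "flag_curvature F x y u =
      (\<Xi> x y * (u \<bullet> (fund_tensor F x y *v u)) + (\<tau> x y \<bullet> u) * (dual x y \<bullet> u))
      / ((y \<bullet> dual x y) * (u \<bullet> (fund_tensor F x y *v u)) - (dual x y \<bullet> u)\<^sup>2)"
    if xy: "x \<in> \<Omega>" "y \<noteq> 0" for x y u
  proof -
    let ?g = "fund_tensor F x y"
    have q: "(\<Sum>i\<in>UNIV. \<Sum>j\<in>UNIV. ?g $ i $ j * v $ i * u $ j) = v \<bullet> (?g *v u)" for v
      by (simp add: inner_vec_def matrix_vector_mult_def sum_distrib_left mult_ac)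
    have R: "riemann_curvature F i k x y = \<Xi> x y * (if i = k then 1 else 0) + \<tau> x y $ k * y $ i" for i k
      using riemann_curvature_projective[OF P GP xy, of i k] by (simp add: \<Xi>_def \<tau>_def Q_def)
    have "(\<Sum>k\<in>UNIV. ?g $ i $ m * riemann_curvature F i k x y * u $ k * u $ m)
        = \<Xi> x y * (?g $ i $ m * u $ i * u $ m) + (\<tau> x y \<bullet> u) * (?g $ i $ m * y $ i * u $ m)" for i m
    proof -
      have "(\<Sum>k\<in>UNIV. ?g $ i $ m * riemann_curvature F i k x y * u $ k * u $ m)
          = (\<Sum>k\<in>UNIV. (if i = k then \<Xi> x y * (?g $ i $ m * u $ k * u $ m) else 0)
              + (\<tau> x y $ k * u $ k) * (?g $ i $ m * y $ i * u $ m))"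
        by (intro sum.cong) (auto simp: R algebra_simps)
      then show ?thesis
        by (simp add: sum.distrib sum_distrib_right[symmetric] inner_vec_def)
    qed
    then have "(\<Sum>i\<in>UNIV. \<Sum>m\<in>UNIV. \<Sum>k\<in>UNIV. ?g $ i $ m * riemann_curvature F i k x y * u $ k * u $ m)
        = \<Xi> x y * (u \<bullet> (?g *v u)) + (\<tau> x y \<bullet> u) * (y \<bullet> (?g *v u))"
      unfolding q[symmetric] by (simp add: sum.distrib sum_distrib_left)
    then show ?thesis
      unfolding flag_curvature_def Let_def q using xy
      by (simp add: fund_tensor_contract_left inner_dual)
  qed
  have key: "(\<forall>u. u \<notin> span {y} \<longrightarrow> flag_curvature F x y u = -1) \<longleftrightarrow> \<Xi> x y = - L x y \<and> \<tau> x y = dual x y"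
    if xy: "x \<in> \<Omega>" "y \<noteq> 0" for x y
    using flag_quotient_eq_iff[OF dim xy(2) fund_tensor_pos[OF xy] fund_tensor_contract_right[OF xy]
        fund_tensor_contract_left[OF xy], of "\<Xi> x y" "\<tau> x y"]
    unfolding flag[OF xy] inner_dual[OF xy] by simp
  have Qk: "pdy k Q x y = 2 * P x y * pdy k P x y + 2 * F x y * pdy k F x y"
    if "\<forall>x\<in>\<Omega>. \<forall>y. y \<noteq> 0 \<longrightarrow> Q x y = (P x y)\<^sup>2 + L x y" and xy: "x \<in> \<Omega>" "y \<noteq> 0" for x y k
  proof -
    have "pdy k Q x y = pdy k (\<lambda>x y. (P x y)\<^sup>2 + L x y) x y"
      using that by (intro pdy_cong) auto
    then show ?thesis
      using pdy_add[OF smooth_power2[OF P(1)] L_smooth xy] pdy_power2[OF P(1) xy] pdy_power2[OF F_smooth xy]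
      by simp
  qed
  show ?thesis
  proof
    assume "constant_flag_curvature \<Omega> F (-1)"
    then have *: "\<Xi> x y = - L x y \<and> \<tau> x y = dual x y" if "x \<in> \<Omega>" "y \<noteq> 0" for x y
      using key[OF that] that unfolding constant_flag_curvature_def by blast
    then have Q: "\<forall>x\<in>\<Omega>. \<forall>y. y \<noteq> 0 \<longrightarrow> Q x y = (P x y)\<^sup>2 + L x y"
      by (simp add: \<Xi>_def algebra_simps)
    show "\<forall>x\<in>\<Omega>. \<forall>y k. y \<noteq> 0 \<longrightarrow> pdx k P x y = P x y * pdy k P x y + F x y * pdy k F x y"
    proof (intro ballI allI impI)
      fix x y k
      assume xy: "x \<in> \<Omega>" "y \<noteq> (0 :: real^'n)"
      have "3 * pdx k P x y - pdy k Q x y - P x y * pdy k P x y = F x y * pdy k F x y"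
        using *[OF xy] by (simp add: \<tau>_def dual_def vec_eq_iff)
      then show "pdx k P x y = P x y * pdy k P x y + F x y * pdy k F x y"
        using Qk[OF Q xy, of k] by simp
    qed
  next
    assume R: "\<forall>x\<in>\<Omega>. \<forall>y k. y \<noteq> 0 \<longrightarrow> pdx k P x y = P x y * pdy k P x y + F x y * pdy k F x y"
    have Q: "\<forall>x\<in>\<Omega>. \<forall>y. y \<noteq> 0 \<longrightarrow> Q x y = (P x y)\<^sup>2 + L x y"
    proof (intro ballI allI impI)
      fix x y :: "real^'n"
      assume xy: "x \<in> \<Omega>" "y \<noteq> 0"
      have "Q x y = P x y * (\<Sum>j\<in>UNIV. pdy j P x y * y $ j) + F x y * (\<Sum>j\<in>UNIV. pdy j F x y * y $ j)"
        using R xy by (simp add: Q_def sum_distrib_left sum.distrib[symmetric] algebra_simps)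
      then show "Q x y = (P x y)\<^sup>2 + L x y"
        using euler[OF P xy] euler[OF F_smooth F_homogeneous xy] by (simp add: power2_eq_square)
    qed
    have "\<Xi> x y = - L x y \<and> \<tau> x y = dual x y" if xy: "x \<in> \<Omega>" "y \<noteq> 0" for x y
      using Q Qk[OF Q xy] R xy by (simp add: \<Xi>_def \<tau>_def dual_def vec_eq_iff)
    then show "constant_flag_curvature \<Omega> F (-1)"
      using key unfolding constant_flag_curvature_def by blast
  qed
qed

text \<open>On a geodesic leaving \<open>x\<close> with velocity \<open>y\<close>, every linear
  functional that kills the direction \<open>u\<close> of the line is constant. Differentiating once
  and twice shows that velocity and acceleration at time 0 are both multiples of \<open>u\<close>,
  and the velocity is not zero.\<close>

lemma projectively_flat_imp_parallel:
  assumes flat: "projectively_flat \<Omega> F" and xy: "x \<in> \<Omega>" "y \<noteq> 0"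
  shows "\<exists>c. \<forall>i. G i x y = c * y $ i"
proof -
  obtain \<delta> and \<gamma> v :: "real \<Rightarrow> real^'n" where \<delta>: "\<delta> > 0" and 0: "\<gamma> 0 = x" "v 0 = y"
    and sol: "\<And>t. t \<in> {-\<delta><..<\<delta>} \<Longrightarrow> \<gamma> t \<in> \<Omega> \<and> v t \<noteq> 0 \<and> (\<gamma> has_vector_derivative v t) (at t) \<and>
      (v has_vector_derivative (\<chi> i. - 2 * G i (\<gamma> t) (v t))) (at t)"
    by (rule geodesic_flow_exists[where G = G, OF geodesic_coeff_smooth xy]) (rule that)
  let ?I = "{-\<delta><..<\<delta>}" and ?a = "\<chi> i. - 2 * G i x y"
  have "geodesic \<Omega> F ?I \<gamma>"
    unfolding geodesic_def using sol by (auto intro!: exI[of _ v] is_interval_oo)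
  with flat have "collinear (\<gamma> ` ?I)"
    by (auto simp: projectively_flat_def)
  then obtain u where u: "\<forall>s\<in>?I. \<forall>t\<in>?I. \<exists>c. \<gamma> s - \<gamma> t = c *\<^sub>R u"
    unfolding collinear_def by blast
  have zero: "w \<bullet> v t = 0" if w: "w \<bullet> u = 0" and t: "t \<in> ?I" for w t
  proof -
    have const: "w \<bullet> \<gamma> s = w \<bullet> \<gamma> 0" if s: "s \<in> ?I" for s
    proof -
      obtain c where "\<gamma> s - \<gamma> 0 = c *\<^sub>R u"
        using u s \<delta> by force
      then show ?thesis
        using w by (metis inner_diff_right inner_scaleR_right mult_zero_right right_minus_eq)
    qed
    have "((\<lambda>s. w \<bullet> \<gamma> s) has_vector_derivative w \<bullet> v t) (at t)"
      using sol[OF t] bounded_linear.has_vector_derivative[OF bounded_linear_inner_right] by blast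
    moreover have "((\<lambda>s. w \<bullet> \<gamma> s) has_vector_derivative 0) (at t)"
      using has_vector_derivative_transform_within_open[OF has_vector_derivative_const open_greaterThanLessThan t]
        const by metis
    ultimately show ?thesis
      using vector_derivative_unique_at by blast
  qed
  have a0: "w \<bullet> ?a = 0" if w: "w \<bullet> u = 0" for w
  proof -
    have 0: "0 \<in> ?I" using \<delta> by simp
    have "((\<lambda>s. w \<bullet> v s) has_vector_derivative w \<bullet> ?a) (at 0)"
      using sol[OF 0] \<open>\<gamma> 0 = x\<close> \<open>v 0 = y\<close> bounded_linear.has_vector_derivative[OF bounded_linear_inner_right] by blast
    moreover have "((\<lambda>s. w \<bullet> v s) has_vector_derivative 0) (at 0)"
      using has_vector_derivative_transform_within_open[OF has_vector_derivative_const open_greaterThanLessThan 0]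
        zero[OF w] by metis
    ultimately show ?thesis
      using vector_derivative_unique_at by blast
  qed
  \<comment> \<open>A vector orthogonal to the orthogonal complement of \<open>u\<close> is a
    multiple of \<open>u\<close>. For \<open>u = 0\<close> the quotient is zero and the claim says
    \<open>b = 0\<close>.\<close>
  have par: "b = (b \<bullet> u / (u \<bullet> u)) *\<^sub>R u" if b: "\<And>w. w \<bullet> u = 0 \<Longrightarrow> w \<bullet> b = 0" for b
  proof (cases "u = 0")
    case True
    then have "b \<bullet> b = 0" using b[of b] by simp
    then show ?thesis by (simp add: True)
  next
    case False
    let ?w = "b - (b \<bullet> u / (u \<bullet> u)) *\<^sub>R u"
    have wu: "?w \<bullet> u = 0"
      using False by (simp add: inner_diff_left)
    have "?w \<bullet> ?w = ?w \<bullet> b - (b \<bullet> u / (u \<bullet> u)) * (?w \<bullet> u)"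
      by (simp add: inner_diff_right)
    then have "?w \<bullet> ?w = 0"
      using b[OF wu] wu by simp
    then show ?thesis by simp
  qed
  have y_eq: "y = (y \<bullet> u / (u \<bullet> u)) *\<^sub>R u"
    using zero[of _ 0] \<delta> 0 by (intro par) auto
  have a_eq: "?a = (?a \<bullet> u / (u \<bullet> u)) *\<^sub>R u"
    by (intro par a0)
  define c where "c = (?a \<bullet> u / (u \<bullet> u)) / (y \<bullet> u / (u \<bullet> u))"
  have "y \<bullet> u / (u \<bullet> u) \<noteq> 0"
    using y_eq xy(2) by (metis scaleR_zero_left)
  then have "?a = c *\<^sub>R ((y \<bullet> u / (u \<bullet> u)) *\<^sub>R u)"
    using a_eq by (simp add: c_def)
  then have "?a = c *\<^sub>R y"
    using y_eq by simp
  then have neg: "- 2 * G i x y = c * y $ i" for i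
    by (metis vec_lambda_beta vector_scaleR_component real_scaleR_def)
  have "G i x y = (- c / 2) * y $ i" for i
    using neg[of i] by simp
  then show ?thesis by blast
qed

text \<open>The velocity satisfies \<open>v' = - 2 P v\<close>, so each component
  \<open>w \<bullet> v\<close> solves a scalar homogeneous linear ODE. Components orthogonal to the
  velocity at one time therefore vanish at all times, and the curve stays on a line.\<close>

lemma projectively_flatI:
  assumes P: "smooth P" and GP: "\<And>x y i. x \<in> \<Omega> \<Longrightarrow> y \<noteq> 0 \<Longrightarrow> G i x y = P x y * y $ i"
  shows "projectively_flat \<Omega> F"
  unfolding projectively_flat_def
proof (intro allI impI)
  fix I and \<gamma> :: "real \<Rightarrow> real^'n"
  assume "geodesic \<Omega> F I \<gamma>"
  then obtain v :: "real \<Rightarrow> real^'n" where I: "open I" "is_interval I"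
    and sol: "\<forall>t\<in>I. \<gamma> t \<in> \<Omega> \<and> v t \<noteq> 0 \<and> (\<gamma> has_vector_derivative v t) (at t) \<and>
      (v has_vector_derivative (\<chi> i. - 2 * G i (\<gamma> t) (v t))) (at t)"
    unfolding geodesic_def by (elim conjE exE) (rule that)
  note sol = bspec[OF sol]
  have \<gamma>': "(\<gamma> has_vector_derivative v t) (at t)" if "t \<in> I" for t
    using sol that by blast
  have v': "(v has_vector_derivative (- 2 * P (\<gamma> t) (v t)) *\<^sub>R v t) (at t)" if "t \<in> I" for t
  proof -
    have "(\<chi> i. - 2 * G i (\<gamma> t) (v t)) = (- 2 * P (\<gamma> t) (v t)) *\<^sub>R v t"
      using GP sol that by (simp add: vec_eq_iff)
    then show ?thesis using sol that by metis
  qed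
  have "continuous_on I (\<lambda>t. (\<gamma> t, v t))"
    using has_vector_derivative_continuous[OF \<gamma>'] has_vector_derivative_continuous[OF v']
    by (intro continuous_at_imp_continuous_on ballI continuous_Pair)
  moreover have "continuous_on (\<Omega> \<times> (UNIV - {0})) (\<lambda>(x, y). P x y)"
    using smooth_isCont[OF P] by (intro continuous_at_imp_continuous_on) auto
  ultimately have cont: "continuous_on I (\<lambda>t. P (\<gamma> t) (v t))"
    using continuous_on_compose2[of _ "\<lambda>(x, y). P x y" I "\<lambda>t. (\<gamma> t, v t)"] sol by fastforce
  show "collinear (\<gamma> ` I)"
  proof (cases "I = {}")
    case False
    then obtain s where s: "s \<in> I" by blast
    have zero: "w \<bullet> v t = 0" if w: "w \<bullet> v s = 0" and t: "t \<in> I" for w t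
    proof -
      let ?J = "{min s t..max s t}"
      have J: "?J \<subseteq> I"
        using mem_is_interval_1_I[OF I(2) s t] mem_is_interval_1_I[OF I(2) t s]
        by (cases "s \<le> t") (auto simp: min_def max_def)
      show ?thesis
      proof (rule linear_ode_zero[where f = "\<lambda>t. w \<bullet> v t" and a = "\<lambda>r. - 2 * P (\<gamma> r) (v r)"
            and p = "min s t" and q = "max s t" and s = s and t = t])
        show "((\<lambda>t. w \<bullet> v t) has_real_derivative (- 2 * P (\<gamma> r) (v r)) * (w \<bullet> v r)) (at r within ?J)"
          if "r \<in> ?J" for r
        proof -
          have "r \<in> I" using J that by blast
          from bounded_linear.has_vector_derivative[OF bounded_linear_inner_right v'[OF this], of w]
          show ?thesis
            by (auto simp: has_real_derivative_iff_has_vector_derivative intro: has_vector_derivative_at_within)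
        qed
        show "continuous_on ?J (\<lambda>r. - 2 * P (\<gamma> r) (v r))"
          by (intro continuous_intros continuous_on_subset[OF cont J])
      qed (use w in auto)
    qed
    have const: "w \<bullet> \<gamma> t = w \<bullet> \<gamma> r" if w: "w \<bullet> v s = 0" and "t \<in> I" "r \<in> I" for w t r
    proof -
      have "((\<lambda>t. w \<bullet> \<gamma> t) has_real_derivative 0) (at q within I)" if "q \<in> I" for q
        using bounded_linear.has_vector_derivative[OF bounded_linear_inner_right \<gamma>'[OF that], of w] zero[OF w that]
        by (auto simp: has_real_derivative_iff_has_vector_derivative intro: has_vector_derivative_at_within)
      then obtain c where "\<And>q. q \<in> I \<Longrightarrow> w \<bullet> \<gamma> q = c"
        using has_field_derivative_zero_constant[of I "\<lambda>t. w \<bullet> \<gamma> t"] I(2) is_interval_convex_1 by blast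
      then show ?thesis using that by simp
    qed
    show ?thesis
      unfolding collinear_def
    proof (intro exI[of _ "v s"] ballI)
      fix a b
      assume "a \<in> \<gamma> ` I" "b \<in> \<gamma> ` I"
      then obtain t r where tr: "a = \<gamma> t" "b = \<gamma> r" "t \<in> I" "r \<in> I" by blast
      let ?c = "((a - b) \<bullet> v s) / (v s \<bullet> v s)"
      define w where "w = (a - b) - ?c *\<^sub>R v s"
      have w: "w \<bullet> v s = 0"
        using sol[OF s] by (simp add: w_def inner_diff_left)
      have "w \<bullet> (a - b) = 0"
        using const[OF w tr(3,4)] tr by (simp add: inner_diff_right)
      moreover have "w \<bullet> w = w \<bullet> (a - b) - ?c * (w \<bullet> v s)"
        by (subst (2) w_def) (simp only: inner_diff_right inner_scaleR_right)
      ultimately have "w = 0"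
        using w by simp
      then show "\<exists>c. a - b = c *\<^sub>R v s"
        by (intro exI[of _ ?c]) (simp add: w_def)
    qed
  qed simp
qed

lemma flat_curvature_imp:
  assumes "CARD('n) \<ge> 2" "projectively_flat \<Omega> F" "constant_flag_curvature \<Omega> F (-1)"
  obtains P where "smooth P" "homogeneous 1 P"
    "\<And>x y k. x \<in> \<Omega> \<Longrightarrow> y \<noteq> 0 \<Longrightarrow> pdx k F x y = pdy k P x y * F x y + P x y * pdy k F x y"
    "\<And>x y k. x \<in> \<Omega> \<Longrightarrow> y \<noteq> 0 \<Longrightarrow> pdx k P x y = P x y * pdy k P x y + F x y * pdy k F x y"
    "\<And>x y. x \<in> \<Omega> \<Longrightarrow> y \<noteq> 0 \<Longrightarrow> P x y = (\<Sum>m\<in>UNIV. pdx m F x y * y $ m) / (2 * F x y)"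
proof (rule projective_factor)
  show "\<exists>c. \<forall>i. G i x y = c * y $ i" if "x \<in> \<Omega>" "y \<noteq> 0" for x y
    by (rule projectively_flat_imp_parallel[OF assms(2) that])
next
  fix P
  assume P: "smooth P" "homogeneous 1 P"
    and GP: "\<And>x y i. x \<in> \<Omega> \<Longrightarrow> y \<noteq> 0 \<Longrightarrow> G i x y = P x y * y $ i"
    and F: "\<And>x y k. x \<in> \<Omega> \<Longrightarrow> y \<noteq> 0 \<Longrightarrow> pdx k F x y = pdy k P x y * F x y + P x y * pdy k F x y"
    and eq: "\<And>x y. x \<in> \<Omega> \<Longrightarrow> y \<noteq> 0 \<Longrightarrow> P x y = (\<Sum>m\<in>UNIV. pdx m F x y * y $ m) / (2 * F x y)"
  show thesis
    using constant_flag_curvature_iff[OF assms(1) P GP] assms(3) by (intro that[OF P F _ eq]) auto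
qed

lemma flat_curvatureI:
  assumes dim: "CARD('n) \<ge> 2" and P: "smooth P" "homogeneous 1 P"
    and F: "\<And>x y k. x \<in> \<Omega> \<Longrightarrow> y \<noteq> 0 \<Longrightarrow> pdx k F x y = pdy k P x y * F x y + P x y * pdy k F x y"
    and Px: "\<And>x y k. x \<in> \<Omega> \<Longrightarrow> y \<noteq> 0 \<Longrightarrow> pdx k P x y = P x y * pdy k P x y + F x y * pdy k F x y"
  shows "projectively_flat \<Omega> F \<and> constant_flag_curvature \<Omega> F (-1)"
proof -
  have GP: "G i x y = P x y * y $ i" if "x \<in> \<Omega>" "y \<noteq> 0" for x y i
    by (rule geodesic_coeff_eq_projective_factor[OF P F that])
  then show ?thesis
    using projectively_flatI[OF P(1) GP] constant_flag_curvature_iff[OF dim P GP] Px by simp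
qed

end

section \<open>Solutions of the decoupled equation\<close>

lemma convex_scaleR_mem:
  fixes S :: "'a::real_vector set"
  assumes "convex S" "0 \<in> S" "x \<in> S" "0 \<le> t" "t \<le> 1"
  shows "t *\<^sub>R x \<in> S"
  using convexD_alt[OF assms] by simp

text \<open>A dilation of base and fibre only rescales the parameter, and positivity of
  \<open>r\<close> preserves its sign. This absorbs the factor \<open>r\<close> of the theorem into
  \<open>p\<close> and \<open>q\<close>.\<close>

lemma sph_term_scaleR:
  assumes "r > 0"
  shows "sph_term k (r *\<^sub>R x) (r *\<^sub>R y) = sph_term (k * r) x y"
proof -
  have "k\<^sup>2 * (1 - k\<^sup>2 * (norm (r *\<^sub>R x))\<^sup>2) * (norm (r *\<^sub>R y))\<^sup>2 + k ^ 4 * ((r *\<^sub>R x) \<bullet> (r *\<^sub>R y))\<^sup>2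
      = (k * r)\<^sup>2 * (1 - (k * r)\<^sup>2 * (norm x)\<^sup>2) * (norm y)\<^sup>2 + (k * r) ^ 4 * (x \<bullet> y)\<^sup>2"
    by (simp add: power_mult_distrib power2_eq_square power4_eq_xxxx algebra_simps)
  moreover have "sgn (k * r) = sgn k"
    using assms by (simp add: sgn_mult)
  ultimately show ?thesis
    by (simp add: sph_term_def power_mult_distrib power2_eq_square mult_ac)
qed

lemma sph_metric_scaleR:
  assumes "r > 0"
  shows "sph_metric c (r *\<^sub>R x) (r *\<^sub>R y) = (sph_term ((c + 1) * r) x y - sph_term ((c - 1) * r) x y) / 2"
  by (simp add: sph_metric_def sph_term_scaleR[OF assms])

lemma sph_term_zero: "sph_term k x 0 = 0" "sph_term k 0 y = k * norm y"
  by (simp_all add: sph_term_def real_sqrt_mult mult_sgn_abs mult.assoc[symmetric] mult.commute[of "sgn k"]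
      abs_mult_sgn)

text \<open>In a radial direction the radicand collapses to \<open>k^2\<close>, one factor of the
  denominator cancels, and the term becomes \<open>k / (1 - \<sigma> k \<rho>)\<close>.\<close>

lemma sph_term_radial:
  assumes e: "norm e = 1" and s: "\<sigma>\<^sup>2 = 1" and k: "\<bar>k\<bar> * \<bar>\<rho>\<bar> < 1"
  shows "sph_term k (\<rho> *\<^sub>R e) (\<sigma> *\<^sub>R e) * (1 - \<sigma> * k * \<rho>) = k"
proof -
  have ee: "e \<bullet> e = 1"
    using e by (simp add: dot_square_norm)
  have \<sigma>: "\<sigma> * \<sigma> = 1" "\<bar>\<sigma>\<bar> = 1"
    using s by (simp_all add: power2_eq_square[symmetric]) (auto simp: power2_eq_1_iff)
  have "(\<sigma> * k * \<rho>)\<^sup>2 < 1"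
    using k \<sigma>(2) by (simp add: abs_square_less_1 abs_mult)
  then have kr: "(k * \<rho>)\<^sup>2 < 1"
    by (simp add: power_mult_distrib s)
  have "k\<^sup>2 * (1 - k\<^sup>2 * \<rho>\<^sup>2) + k ^ 4 * \<rho>\<^sup>2 = k\<^sup>2"
    by (simp add: power2_eq_square power4_eq_xxxx algebra_simps)
  then have "sph_term k (\<rho> *\<^sub>R e) (\<sigma> *\<^sub>R e) = (k\<^sup>2 * (\<rho> * \<sigma>) + k) / (1 - (k * \<rho>)\<^sup>2)"
    using e s \<sigma> by (simp add: sph_term_def ee power_mult_distrib mult_sgn_abs sgn_mult_abs)
  moreover have "(k\<^sup>2 * (\<rho> * \<sigma>) + k) * (1 - \<sigma> * k * \<rho>) = k * (1 - (\<sigma> * \<sigma>) * (k * \<rho>)\<^sup>2)"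
    by (simp add: power2_eq_square algebra_simps)
  ultimately show ?thesis
    using kr \<sigma>(1) by simp
qed

text \<open>Squaring gives a quadratic equation for \<open>\<phi>\<close>. The lost sign is
  recovered from \<open>\<phi>\<close> having the sign of \<open>k\<close>, which fixes the sign of
  \<open>d * \<phi> - k^2 * s\<close> and with it the branch of the root.\<close>

lemma sph_term_unique:
  assumes D: "k\<^sup>2 * (norm x)\<^sup>2 < 1" and eq: "\<phi> = k * norm (y + \<phi> *\<^sub>R x)"
  shows "\<phi> = sph_term k x y"
proof -
  define d s n where "d = 1 - k\<^sup>2 * (norm x)\<^sup>2" and "s = x \<bullet> y" and "n = (norm y)\<^sup>2"
  have d: "d > 0" using D by (simp add: d_def)
  have "\<phi>\<^sup>2 = k\<^sup>2 * (norm (y + \<phi> *\<^sub>R x))\<^sup>2"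
    using eq by (metis power_mult_distrib)
  also have "(norm (y + \<phi> *\<^sub>R x))\<^sup>2 = n + 2 * \<phi> * s + \<phi>\<^sup>2 * (norm x)\<^sup>2"
    unfolding n_def s_def power2_norm_eq_inner
    by (simp add: inner_add_left inner_add_right inner_commute power2_eq_square algebra_simps)
  finally have q: "\<phi> * (d * \<phi> - 2 * k\<^sup>2 * s) = k\<^sup>2 * n"
    by (simp add: d_def power2_eq_square algebra_simps)
  have sq: "(d * \<phi> - k\<^sup>2 * s)\<^sup>2 = k\<^sup>2 * d * n + k ^ 4 * s\<^sup>2"
  proof -
    have "(d * \<phi> - k\<^sup>2 * s)\<^sup>2 = d * (\<phi> * (d * \<phi> - 2 * k\<^sup>2 * s)) + k ^ 4 * s\<^sup>2"
      by (simp add: power2_eq_square power4_eq_xxxx algebra_simps)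
    then show ?thesis unfolding q by simp
  qed
  have n: "n \<ge> 0" by (simp add: n_def)
  \<comment> \<open>Here the equation forces \<open>y = 0\<close>.\<close>
  have s0: "s = 0" if "\<phi> = 0" "k \<noteq> 0"
    using eq that by (simp add: s_def)
  have "d * \<phi> - k\<^sup>2 * s = sgn k * sqrt (k\<^sup>2 * d * n + k ^ 4 * s\<^sup>2)"
  proof (cases k "0 :: real" rule: linorder_cases)
    case equal
    then show ?thesis using eq by simp
  next
    case greater
    then have "\<phi> \<ge> 0" by (subst eq) simp
    \<comment> \<open>The quantity is the mean of \<open>d * \<phi>\<close> and
      \<open>d * \<phi> - 2 * k^2 * s\<close>; the identity \<open>q\<close> gives both the sign of
      \<open>\<phi>\<close>.\<close>
    have "d * \<phi> - k\<^sup>2 * s \<ge> 0"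
    proof (cases "\<phi> = 0")
      case True
      then show ?thesis using s0 greater by simp
    next
      case False
      with \<open>\<phi> \<ge> 0\<close> have "\<phi> > 0" by simp
      moreover have "0 \<le> \<phi> * (d * \<phi> - 2 * k\<^sup>2 * s)"
        unfolding q using n by simp
      ultimately have "0 \<le> d * \<phi> - 2 * k\<^sup>2 * s" "0 < d * \<phi>"
        using d by (simp_all add: zero_le_mult_iff)
      then show ?thesis by simp
    qed
    then show ?thesis
      using greater by (simp add: sq[symmetric])
  next
    case less
    then have "\<phi> \<le> 0" by (subst eq) (simp add: mult_nonpos_nonneg)
    have "d * \<phi> - k\<^sup>2 * s \<le> 0"
    proof (cases "\<phi> = 0")
      case True
      then show ?thesis using s0 less by simp
    next
      case False
      with \<open>\<phi> \<le> 0\<close> have "\<phi> < 0" by simp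
      moreover have "0 \<le> \<phi> * (d * \<phi> - 2 * k\<^sup>2 * s)"
        unfolding q using n by simp
      ultimately have "d * \<phi> - 2 * k\<^sup>2 * s \<le> 0" "d * \<phi> < 0"
        using d by (simp_all add: zero_le_mult_iff mult_pos_neg)
      then show ?thesis by simp
    qed
    then show ?thesis
      using less by (simp add: sq[symmetric])
  qed
  then have "d * \<phi> = k\<^sup>2 * s + sgn k * sqrt (k\<^sup>2 * d * n + k ^ 4 * s\<^sup>2)"
    by simp
  then have "\<phi> = (k\<^sup>2 * s + sgn k * sqrt (k\<^sup>2 * d * n + k ^ 4 * s\<^sup>2)) / d"
    using d by (simp add: field_simps)
  then show ?thesis
    by (simp add: sph_term_def d_def s_def n_def)
qed

text \<open>The second claim says that the root is simple: up to a factor 2 its left side is the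
  derivative of the quadratic in \<open>T\<close>, and it equals plus or minus the root of a
  positive radicand. \<open>pdx_sph_term\<close> divides by it.\<close>

lemma sph_term_quadratic:
  fixes x y :: "real^'n::finite"
  assumes D: "k\<^sup>2 * (norm x)\<^sup>2 < 1"
  defines "T \<equiv> sph_term k x y"
  shows "T\<^sup>2 = k\<^sup>2 * (y \<bullet> y + 2 * T * (x \<bullet> y) + T\<^sup>2 * (x \<bullet> x))"
    and "k \<noteq> 0 \<Longrightarrow> y \<noteq> 0 \<Longrightarrow> T - k\<^sup>2 * (x \<bullet> y) - k\<^sup>2 * T * (x \<bullet> x) \<noteq> 0"
proof -
  define d s n where "d = 1 - k\<^sup>2 * (norm x)\<^sup>2" and "s = x \<bullet> y" and "n = (norm y)\<^sup>2"
  define R where "R = k\<^sup>2 * d * n + k ^ 4 * s\<^sup>2"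
  have d: "d > 0" using D by (simp add: d_def)
  have R: "R \<ge> 0" using d by (simp add: R_def n_def)
  have T: "d * T - k\<^sup>2 * s = sgn k * sqrt R"
    using d by (simp add: T_def sph_term_def d_def s_def n_def R_def)
  then have "(d * T - k\<^sup>2 * s)\<^sup>2 = R"
    using R by (cases "k = 0") (simp_all add: power_mult_distrib R_def sgn_if)
  then have "d * (d * T\<^sup>2 - 2 * k\<^sup>2 * s * T - k\<^sup>2 * n) = 0"
    by (simp add: R_def power2_eq_square power4_eq_xxxx algebra_simps)
  then have "d * T\<^sup>2 - 2 * k\<^sup>2 * s * T - k\<^sup>2 * n = 0"
    using d by simp
  then show "T\<^sup>2 = k\<^sup>2 * (y \<bullet> y + 2 * T * (x \<bullet> y) + T\<^sup>2 * (x \<bullet> x))"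
    by (simp add: d_def n_def s_def power2_norm_eq_inner algebra_simps)
  assume "k \<noteq> 0" "y \<noteq> 0"
  then have "R > 0"
    using d by (simp add: R_def n_def add_pos_nonneg)
  then have "d * T - k\<^sup>2 * s \<noteq> 0"
    using T \<open>k \<noteq> 0\<close> by (simp add: sgn_zero_iff)
  then show "T - k\<^sup>2 * (x \<bullet> y) - k\<^sup>2 * T * (x \<bullet> x) \<noteq> 0"
    by (simp add: d_def s_def power2_norm_eq_inner algebra_simps)
qed

section \<open>The explicit terms solve the decoupled equation\<close>

context slit_domain
begin

lemma homogeneous_sph_term: "homogeneous 1 (sph_term k)"
  unfolding homogeneous_def
proof (intro ballI allI impI)
  fix x y :: "real^'n" and t :: real
  assume "t > 0"
  have "k\<^sup>2 * (1 - k\<^sup>2 * (norm x)\<^sup>2) * (norm (t *\<^sub>R y))\<^sup>2 + k ^ 4 * (x \<bullet> (t *\<^sub>R y))\<^sup>2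
      = t\<^sup>2 * (k\<^sup>2 * (1 - k\<^sup>2 * (norm x)\<^sup>2) * (norm y)\<^sup>2 + k ^ 4 * (x \<bullet> y)\<^sup>2)"
    by (simp add: power_mult_distrib algebra_simps)
  then have "sqrt (k\<^sup>2 * (1 - k\<^sup>2 * (norm x)\<^sup>2) * (norm (t *\<^sub>R y))\<^sup>2 + k ^ 4 * (x \<bullet> (t *\<^sub>R y))\<^sup>2)
      = t * sqrt (k\<^sup>2 * (1 - k\<^sup>2 * (norm x)\<^sup>2) * (norm y)\<^sup>2 + k ^ 4 * (x \<bullet> y)\<^sup>2)"
    using \<open>t > 0\<close> by (simp add: real_sqrt_mult)
  then show "sph_term k x (t *\<^sub>R y) = t ^ 1 * sph_term k x y"
    unfolding sph_term_def by (simp add: distrib_left mult_ac)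
qed

context
  fixes k :: real
  assumes small: "\<And>x. x \<in> \<Omega> \<Longrightarrow> k\<^sup>2 * (norm x)\<^sup>2 < 1"
begin

lemma smooth_sph_term: "smooth (sph_term k)"
proof (cases "k = 0")
  case True
  then have "sph_term k = (\<lambda>(x :: real^'n) y. 0)"
    by (simp add: sph_term_def fun_eq_iff)
  then show ?thesis using smooth_const by simp
next
  case False
  have "smooth (\<lambda>x y. k\<^sup>2 * (1 - k\<^sup>2 * (norm x)\<^sup>2) * (norm y)\<^sup>2 + k ^ 4 * (x \<bullet> y)\<^sup>2)"
    by (intro smooth_intros smooth_inner)
  moreover have "0 < k\<^sup>2 * (1 - k\<^sup>2 * (norm x)\<^sup>2) * (norm y)\<^sup>2 + k ^ 4 * (x \<bullet> y)\<^sup>2"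
    if "x \<in> \<Omega>" "y \<noteq> 0" for x y
    using small[OF that(1)] that False by (intro add_pos_nonneg mult_pos_pos) auto
  ultimately have "smooth (\<lambda>x y. sqrt (k\<^sup>2 * (1 - k\<^sup>2 * (norm x)\<^sup>2) * (norm y)\<^sup>2 + k ^ 4 * (x \<bullet> y)\<^sup>2))"
    by (rule smooth_sqrt)
  then have "smooth (\<lambda>x y. (k\<^sup>2 * (x \<bullet> y)
      + sgn k * sqrt (k\<^sup>2 * (1 - k\<^sup>2 * (norm x)\<^sup>2) * (norm y)\<^sup>2 + k ^ 4 * (x \<bullet> y)\<^sup>2))
      / (1 - k\<^sup>2 * (norm x)\<^sup>2))"
    using small by (intro smooth_divide smooth_intros smooth_inner) force+
  then show ?thesis
    by (rule smooth_cong) (simp add: sph_term_def)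
qed

text \<open>Implicit differentiation of the quadratic in \<open>x\<close> and in \<open>y\<close>
  produces the same simple-root factor; the inhomogeneous terms
  \<open>k^2 * T * (y $ l + T * x $ l)\<close> and \<open>k^2 * (y $ l + T * x $ l)\<close> differ
  exactly by the factor \<open>T\<close>.\<close>

lemma pdx_sph_term:
  assumes xy: "x \<in> \<Omega>" "y \<noteq> 0"
  shows "pdx l (sph_term k) x y = sph_term k x y * pdy l (sph_term k) x y"
proof (cases "k = 0")
  case True
  then have "sph_term k = (\<lambda>(x :: real^'n) y. 0)"
    by (simp add: sph_term_def fun_eq_iff)
  then show ?thesis
    by (simp add: pdx_const)
next
  case False
  let ?e = "axis l 1 :: real^'n"
  define T where "T = sph_term k x y"
  define Q where "Q a b c u = a\<^sup>2 - k\<^sup>2 * (b + 2 * a * c + a\<^sup>2 * u)" for a b c u :: real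
  have ax: "(x + t *\<^sub>R ?e) \<bullet> y = x \<bullet> y + t * y $ l" "(x + t *\<^sub>R ?e) \<bullet> (x + t *\<^sub>R ?e) = x \<bullet> x + 2 * t * x $ l + t\<^sup>2" for t
    by (simp_all add: inner_add_left inner_add_right inner_axis inner_commute[of ?e] power2_eq_square algebra_simps)
  have ay: "x \<bullet> (y + t *\<^sub>R ?e) = x \<bullet> y + t * x $ l" "(y + t *\<^sub>R ?e) \<bullet> (y + t *\<^sub>R ?e) = y \<bullet> y + 2 * t * y $ l + t\<^sup>2" for t
    by (simp_all add: inner_add_left inner_add_right inner_axis inner_commute[of ?e] power2_eq_square algebra_simps)
  have 1: "((\<lambda>t. Q (sph_term k (x + t *\<^sub>R ?e) y) (y \<bullet> y) (x \<bullet> y + t * y $ l) (x \<bullet> x + 2 * t * x $ l + t\<^sup>2))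
     has_real_derivative
      2 * (pdx l (sph_term k) x y * (T - k\<^sup>2 * (x \<bullet> y) - k\<^sup>2 * T * (x \<bullet> x)) - k\<^sup>2 * T * (y $ l + T * x $ l))) (at 0)"
    unfolding Q_def using DERIV_x[OF smooth_sph_term xy, of l]
    by (auto intro!: derivative_eq_intros simp: T_def power2_eq_square algebra_simps)
  have "\<forall>\<^sub>F t in nhds 0. Q (sph_term k (x + t *\<^sub>R ?e) y) (y \<bullet> y) (x \<bullet> y + t * y $ l) (x \<bullet> x + 2 * t * x $ l + t\<^sup>2) = 0"
    using eventually_slit_line(1)[OF xy, of ?e]
  proof eventually_elim
    case (elim t)
    from sph_term_quadratic(1)[OF small[OF elim], of y] show ?case
      unfolding Q_def ax[symmetric] by simp
  qed
  with 1 have x: "2 * (pdx l (sph_term k) x y * (T - k\<^sup>2 * (x \<bullet> y) - k\<^sup>2 * T * (x \<bullet> x)) - k\<^sup>2 * T * (y $ l + T * x $ l)) = 0"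
    using DERIV_cong_ev[OF refl _ refl] DERIV_const DERIV_unique by fastforce
  have 2: "((\<lambda>t. Q (sph_term k x (y + t *\<^sub>R ?e)) (y \<bullet> y + 2 * t * y $ l + t\<^sup>2) (x \<bullet> y + t * x $ l) (x \<bullet> x))
     has_real_derivative
      2 * (pdy l (sph_term k) x y * (T - k\<^sup>2 * (x \<bullet> y) - k\<^sup>2 * T * (x \<bullet> x)) - k\<^sup>2 * (y $ l + T * x $ l))) (at 0)"
    unfolding Q_def using DERIV_y[OF smooth_sph_term xy, of l]
    by (auto intro!: derivative_eq_intros simp: T_def power2_eq_square algebra_simps)
  have "Q (sph_term k x (y + t *\<^sub>R ?e)) (y \<bullet> y + 2 * t * y $ l + t\<^sup>2) (x \<bullet> y + t * x $ l) (x \<bullet> x) = 0" for t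
    using sph_term_quadratic(1)[OF small[OF xy(1)], of "y + t *\<^sub>R ?e"]
    unfolding Q_def ay[symmetric] by simp
  with 2 have y: "2 * (pdy l (sph_term k) x y * (T - k\<^sup>2 * (x \<bullet> y) - k\<^sup>2 * T * (x \<bullet> x)) - k\<^sup>2 * (y $ l + T * x $ l)) = 0"
    using DERIV_const DERIV_unique by fastforce
  have "(pdx l (sph_term k) x y - T * pdy l (sph_term k) x y) * (T - k\<^sup>2 * (x \<bullet> y) - k\<^sup>2 * T * (x \<bullet> x)) = 0"
    using x y by algebra
  then show ?thesis
    using sph_term_quadratic(2)[OF small[OF xy(1)] False xy(2)] by (simp add: T_def)
qed

end

section \<open>Characteristics: every solution is an explicit term\<close>

context
  fixes \<Phi> :: "real^'n \<Rightarrow> real^'n \<Rightarrow> real" and k :: real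
  assumes dim: "CARD('n) \<ge> 2" and cvx: "convex \<Omega>" "0 \<in> \<Omega>"
    and \<Phi>: "smooth \<Phi>"
    and pde: "\<And>x y l. x \<in> \<Omega> \<Longrightarrow> y \<noteq> 0 \<Longrightarrow> pdx l \<Phi> x y = \<Phi> x y * pdy l \<Phi> x y"
    and init: "\<And>y. y \<noteq> 0 \<Longrightarrow> \<Phi> 0 y = k * norm y"
begin

text \<open>
  Along the characteristic \<open>t \<mapsto> (t x, y + (1 - t) \<Phi>(x, y) x)\<close> the function \<open>\<Phi> - \<Phi>(x, y)\<close> satisfies
  a homogeneous linear ODE and vanishes at \<open>t = 1\<close>.  The independence of \<open>x\<close> and \<open>y\<close> keeps the
  characteristic away from the zero section.
\<close>

lemma funk_generic:
  assumes x: "x \<in> \<Omega>" and ind: "y \<notin> span {x}"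
  shows "\<Phi> x y = k * norm (y + \<Phi> x y *\<^sub>R x)"
proof -
  define \<phi> where "\<phi> = \<Phi> x y"
  let ?\<alpha> = "\<lambda>t. t *\<^sub>R x" and ?\<beta> = "\<lambda>t. y + ((1 - t) * \<phi>) *\<^sub>R x"
  have nz: "?\<beta> t \<noteq> 0" for t
  proof
    assume "?\<beta> t = 0"
    then have "y = (- ((1 - t) * \<phi>)) *\<^sub>R x"
      by (simp add: eq_neg_iff_add_eq_0)
    then show False
      using ind by (metis insertI1 span_base span_mul)
  qed
  have "\<Phi> (?\<alpha> 0) (?\<beta> 0) - \<phi> = 0"
  proof (rule linear_ode_zero[where f = "\<lambda>t. \<Phi> (?\<alpha> t) (?\<beta> t) - \<phi>" and p = 0 and q = 1 and s = 1 and t = 0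
        and a = "\<lambda>t. \<Sum>l\<in>UNIV. x $ l * pdy l \<Phi> (?\<alpha> t) (?\<beta> t)"])
    fix t :: real
    assume "t \<in> {0..1}"
    then have m: "?\<alpha> t \<in> \<Omega>"
      using convex_scaleR_mem[OF cvx x] by simp
    have "((\<lambda>t. \<Phi> (?\<alpha> t) (?\<beta> t)) has_real_derivative
        (\<Sum>l\<in>UNIV. x $ l * pdx l \<Phi> (?\<alpha> t) (?\<beta> t)) + (\<Sum>l\<in>UNIV. ((- \<phi>) *\<^sub>R x) $ l * pdy l \<Phi> (?\<alpha> t) (?\<beta> t))) (at t)"
      by (intro DERIV_curve smooth_differentiable[OF \<Phi> m nz]) (auto intro!: derivative_eq_intros)
    moreover have "(\<Sum>l\<in>UNIV. x $ l * pdx l \<Phi> (?\<alpha> t) (?\<beta> t)) + (\<Sum>l\<in>UNIV. ((- \<phi>) *\<^sub>R x) $ l * pdy l \<Phi> (?\<alpha> t) (?\<beta> t))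
        = (\<Sum>l\<in>UNIV. x $ l * pdy l \<Phi> (?\<alpha> t) (?\<beta> t)) * (\<Phi> (?\<alpha> t) (?\<beta> t) - \<phi>)"
      unfolding pde[OF m nz] by (simp add: sum_distrib_right sum_distrib_left algebra_simps sum_subtractf sum_negf)
    ultimately show "((\<lambda>t. \<Phi> (?\<alpha> t) (?\<beta> t) - \<phi>) has_real_derivative
        (\<Sum>l\<in>UNIV. x $ l * pdy l \<Phi> (?\<alpha> t) (?\<beta> t)) * (\<Phi> (?\<alpha> t) (?\<beta> t) - \<phi>)) (at t within {0..1})"
      by (auto intro!: derivative_eq_intros intro: has_field_derivative_at_within)
  next
    have "continuous_on {0..1} (\<lambda>t. (?\<alpha> t, ?\<beta> t))"
      by (intro continuous_intros)
    moreover have "continuous_on (\<Omega> \<times> (UNIV - {0})) (\<lambda>(x, y). pdy l \<Phi> x y)" for l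
      using smooth_isCont[OF smooth_pdy[OF \<Phi>]] by (intro continuous_at_imp_continuous_on) auto
    moreover have "(\<lambda>t. (?\<alpha> t, ?\<beta> t)) ` {0..1} \<subseteq> \<Omega> \<times> (UNIV - {0})"
      using convex_scaleR_mem[OF cvx x] nz by auto
    ultimately have "continuous_on {0..1} (\<lambda>t. case (?\<alpha> t, ?\<beta> t) of (x, y) \<Rightarrow> pdy l \<Phi> x y)" for l
      using continuous_on_compose2[where g = "\<lambda>(x, y). pdy l \<Phi> x y" and f = "\<lambda>t. (?\<alpha> t, ?\<beta> t)"] by blast
    then show "continuous_on {0..1} (\<lambda>t. \<Sum>l\<in>UNIV. x $ l * pdy l \<Phi> (?\<alpha> t) (?\<beta> t))"
      by (intro continuous_intros) simp
  qed (auto simp: \<phi>_def)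
  \<comment> \<open>At \<open>t = 0\<close> the characteristic lies over the origin with fibre
    coordinate \<open>y + \<phi> x\<close>, where \<open>init\<close> applies.\<close>
  then show ?thesis
    using init[OF nz[of 0]] by (simp add: \<phi>_def)
qed

text \<open>For \<open>y\<close> parallel to \<open>x\<close>, where the characteristic could run
  into the zero section, \<open>y\<close> is the limit of \<open>y + t w\<close> with
  \<open>w\<close> orthogonal to \<open>x\<close>, and both sides are continuous in the
  fibre.\<close>

lemma funk_equation:
  assumes xy: "x \<in> \<Omega>" "y \<noteq> 0"
  shows "\<Phi> x y = k * norm (y + \<Phi> x y *\<^sub>R x)"
proof (cases "x = 0")
  case True
  then show ?thesis using init xy by simp
next
  case False
  show ?thesis
  proof (cases "y \<in> span {x}")
    case True
    then obtain c where c: "y = c *\<^sub>R x"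
      by (auto simp: span_singleton)
    obtain w where w: "w \<noteq> 0" "x \<bullet> w = 0"
      using orthogonal_to_vector_exists[of x] dim by (auto simp: orthogonal_def)
    define D where "D t = \<Phi> x (y + t *\<^sub>R w) - k * norm (y + t *\<^sub>R w + \<Phi> x (y + t *\<^sub>R w) *\<^sub>R x)" for t
    have "D t = 0" if "t \<noteq> 0" for t
    proof -
      have "y + t *\<^sub>R w \<notin> span {x}"
      proof
        assume "y + t *\<^sub>R w \<in> span {x}"
        then obtain c' where "y + t *\<^sub>R w = c' *\<^sub>R x"
          by (auto simp: span_singleton)
        then have "t *\<^sub>R w = (c' - c) *\<^sub>R x"
          by (simp add: c algebra_simps)
        then have "w \<bullet> (t *\<^sub>R w) = 0"
          using w(2) by (simp add: inner_commute)
        then show False using w that by simp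
      qed
      from funk_generic[OF xy(1) this] show ?thesis by (simp add: D_def)
    qed
    then have "(D \<longlongrightarrow> 0) (at 0)"
      by (intro tendsto_eventually) (simp add: eventually_at_filter)
    moreover have "isCont D 0"
    proof -
      have "isCont (\<lambda>(x, y). \<Phi> x y) (x, y + 0 *\<^sub>R w)"
        using smooth_isCont[OF \<Phi> xy] by simp
      moreover have "isCont (\<lambda>t. (x, y + t *\<^sub>R w)) 0"
        by (intro continuous_intros)
      ultimately have "isCont (\<lambda>t. case (x, y + t *\<^sub>R w) of (x, y) \<Rightarrow> \<Phi> x y) 0"
        using isCont_o2[where f = "\<lambda>t. (x, y + t *\<^sub>R w)" and g = "\<lambda>(x, y). \<Phi> x y" and a = 0] by blast
      then have "isCont (\<lambda>t. \<Phi> x (y + t *\<^sub>R w)) 0"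
        by simp
      then show ?thesis
        unfolding D_def by (intro continuous_intros)
    qed
    ultimately have "D 0 = 0"
      unfolding isCont_def using LIM_unique by blast
    then show ?thesis by (simp add: D_def)
  qed (rule funk_generic[OF xy(1)])
qed

text \<open>On the sphere of radius \<open>1 / \<bar>k\<bar>\<close> the equation \<open>\<phi> = k \<bar>y + \<phi> x\<bar>\<close> has no solution for \<open>y = sgn(k) x\<close>.\<close>

lemma funk_domain_bound:
  assumes x: "x \<in> \<Omega>"
  shows "k\<^sup>2 * (norm x)\<^sup>2 < 1"
proof (rule ccontr)
  assume "\<not> ?thesis"
  then have "1 \<le> (\<bar>k\<bar> * norm x)\<^sup>2"
    by (simp add: power_mult_distrib)
  then have ge: "1 \<le> \<bar>k\<bar> * norm x"
    using abs_le_square_iff[of 1 "\<bar>k\<bar> * norm x"] by (simp add: abs_mult)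
  then have k: "k \<noteq> 0" and "x \<noteq> 0"
    by auto
  \<comment> \<open>The point on the segment from 0 to \<open>x\<close> that lies on the critical
    sphere.\<close>
  define z where "z = (1 / (\<bar>k\<bar> * norm x)) *\<^sub>R x"
  have z: "z \<in> \<Omega>"
    unfolding z_def using ge k \<open>x \<noteq> 0\<close> by (intro convex_scaleR_mem[OF cvx x]) auto
  have nz: "norm z = 1 / \<bar>k\<bar>"
    using \<open>x \<noteq> 0\<close> by (simp add: z_def)
  then have "sgn k *\<^sub>R z \<noteq> 0"
    using k by (auto simp: sgn_zero_iff)
  define \<phi> where "\<phi> = \<Phi> z (sgn k *\<^sub>R z)"
  have "\<phi> = k * norm ((sgn k + \<phi>) *\<^sub>R z)"
    using funk_equation[OF z \<open>sgn k *\<^sub>R z \<noteq> 0\<close>] by (simp add: \<phi>_def scaleR_left_distrib)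
  also have "\<dots> = sgn k * \<bar>sgn k + \<phi>\<bar>"
    unfolding norm_scaleR nz using k by (simp add: sgn_if field_simps)
  \<comment> \<open>Now \<open>\<phi>\<close> is zero or has the sign of \<open>k\<close>, so the
    absolute value opens to \<open>\<phi> = \<phi> + sgn k\<close>.\<close>
  finally show False
    using k by (auto simp: sgn_if split: if_splits)
qed

lemma funk_solution: "x \<in> \<Omega> \<Longrightarrow> y \<noteq> 0 \<Longrightarrow> \<Phi> x y = sph_term k x y"
  by (intro sph_term_unique funk_domain_bound funk_equation)

end
end

text \<open>
  On a ray through a unit vector \<open>e\<close>, \<open>F(\<rho> e, \<sigma> e) (1 - \<sigma> p \<rho>) (1 - \<sigma> q \<rho>) = (p - q) / 2\<close> for
  \<open>\<sigma> = \<plusminus>1\<close> as long as no denominator vanishes; at the first zero of a denominator this contradicts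
  the continuity of \<open>F\<close>.
\<close>

lemma sph_difference_domain_bound:
  fixes \<Omega> :: "(real^'n::finite) set"
  assumes cvx: "convex \<Omega>" "0 \<in> \<Omega>" and pq: "q < p"
    and cont: "continuous_on (\<Omega> \<times> (UNIV - {0})) (\<lambda>(x, y). F x y)"
    and F: "\<And>x y. x \<in> \<Omega> \<Longrightarrow> F x y = (sph_term p x y - sph_term q x y) / 2"
    and x: "x \<in> \<Omega>"
  shows "p\<^sup>2 * (norm x)\<^sup>2 < 1 \<and> q\<^sup>2 * (norm x)\<^sup>2 < 1"
proof (rule ccontr)
  define m where "m = max \<bar>p\<bar> \<bar>q\<bar>"
  have m: "m > 0" "\<bar>p\<bar> \<le> m" "\<bar>q\<bar> \<le> m"
    using pq by (auto simp: m_def)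
  assume "\<not> ?thesis"
  then have "1 \<le> (\<bar>p\<bar> * norm x)\<^sup>2 \<or> 1 \<le> (\<bar>q\<bar> * norm x)\<^sup>2"
    by (auto simp: power_mult_distrib)
  then have "1 \<le> \<bar>p\<bar> * norm x \<or> 1 \<le> \<bar>q\<bar> * norm x"
    using abs_le_square_iff[of 1 "\<bar>p\<bar> * norm x"] abs_le_square_iff[of 1 "\<bar>q\<bar> * norm x"] by (simp add: abs_mult)
  then have ge: "1 \<le> m * norm x"
    using m mult_right_mono[OF m(2) norm_ge_zero[of x]] mult_right_mono[OF m(3) norm_ge_zero[of x]] by linarith
  then have "x \<noteq> 0" by auto
  define e where "e = (1 / norm x) *\<^sub>R x"
  have e: "norm e = 1"
    using \<open>x \<noteq> 0\<close> by (simp add: e_def)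
  have mem: "\<rho> *\<^sub>R e \<in> \<Omega>" if "\<rho> \<in> {0..1 / m}" for \<rho>
  proof -
    have "1 / m \<le> norm x"
      using ge m by (simp add: field_simps)
    then have "\<rho> \<le> norm x"
      using that by auto
    then have "0 \<le> \<rho> / norm x" "\<rho> / norm x \<le> 1"
      using that \<open>x \<noteq> 0\<close> by auto
    then show ?thesis
      using convex_scaleR_mem[OF cvx x, of "\<rho> / norm x"] by (simp add: e_def)
  qed
  \<comment> \<open>Outward or inward direction, chosen so that the parameter of larger modulus
    produces a zero of its radial denominator at \<open>\<rho> = 1 / m\<close>.\<close>
  have "\<exists>\<sigma>. \<sigma>\<^sup>2 = 1 \<and> (\<sigma> * p = m \<or> \<sigma> * q = m)"
  proof -
    have "\<exists>\<sigma>. \<sigma>\<^sup>2 = 1 \<and> \<sigma> * a = \<bar>a\<bar>" for a :: real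
      by (cases "a \<ge> 0") (auto intro: exI[of _ 1] exI[of _ "-1"])
    then show ?thesis
      unfolding m_def max_def by metis
  qed
  then obtain \<sigma> where \<sigma>: "\<sigma>\<^sup>2 = 1" "\<sigma> * p = m \<or> \<sigma> * q = m"
    by blast
  define h where "h \<rho> = F (\<rho> *\<^sub>R e) (\<sigma> *\<^sub>R e) * ((1 - \<sigma> * p * \<rho>) * (1 - \<sigma> * q * \<rho>))" for \<rho>
  have se: "\<sigma> *\<^sub>R e \<noteq> 0"
    using e \<sigma>(1) by auto
  have "continuous_on {0..1 / m} (\<lambda>\<rho>. case (\<rho> *\<^sub>R e, \<sigma> *\<^sub>R e) of (x, y) \<Rightarrow> F x y)"
    by (rule continuous_on_compose2[OF cont]) (use mem se in \<open>auto intro!: continuous_intros\<close>)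
  then have "continuous_on {0..1 / m} h"
    unfolding h_def by (intro continuous_intros) simp
  then have "(h \<longlongrightarrow> h (1 / m)) (at (1 / m) within {0..1 / m})"
    using m by (simp add: continuous_on_def)
  then have "(h \<longlongrightarrow> h (1 / m)) (at_left (1 / m))"
    using m by (simp add: at_within_Icc_at_left)
  \<comment> \<open>A factor vanishes here, whatever finite value \<open>F\<close> takes at this
    point.\<close>
  moreover have "h (1 / m) = 0"
    using \<sigma>(2) m by (auto simp: h_def)
  moreover have "\<forall>\<^sub>F \<rho> in at_left (1 / m). h \<rho> = (p - q) / 2"
  proof -
    have "\<forall>\<^sub>F \<rho> in at_left (1 / m). \<rho> \<in> {0<..<1 / m}"
      using m by (intro eventually_at_left_real) simp
    then show ?thesis
    proof eventually_elim
      case (elim \<rho>)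
      then have "m * \<bar>\<rho>\<bar> < 1"
        using m by (auto simp: field_simps)
      then have "\<bar>p\<bar> * \<bar>\<rho>\<bar> < 1" "\<bar>q\<bar> * \<bar>\<rho>\<bar> < 1"
        using mult_right_mono[OF m(2), of "\<bar>\<rho>\<bar>"] mult_right_mono[OF m(3), of "\<bar>\<rho>\<bar>"] by linarith+
      note radial = sph_term_radial[OF e \<sigma>(1) this(1)] sph_term_radial[OF e \<sigma>(1) this(2)]
      have split: "(A - B) * (a * b) = (A * a) * b - (B * b) * a" for A B a b :: real
        by (simp add: algebra_simps)
      have "(sph_term p (\<rho> *\<^sub>R e) (\<sigma> *\<^sub>R e) - sph_term q (\<rho> *\<^sub>R e) (\<sigma> *\<^sub>R e))
          * ((1 - \<sigma> * p * \<rho>) * (1 - \<sigma> * q * \<rho>)) = p - q"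
        unfolding split radial by (simp add: algebra_simps)
      moreover have "\<rho> *\<^sub>R e \<in> \<Omega>"
        using mem elim by auto
      ultimately show ?case
        by (simp add: h_def F)
    qed
  qed
  then have "(h \<longlongrightarrow> (p - q) / 2) (at_left (1 / m))"
    by (rule tendsto_eventually)
  ultimately have "(p - q) / 2 = 0"
    using tendsto_unique[OF trivial_limit_at_left_real] by metis
  then show False using pq by simp
qed

section \<open>From pairs of explicit terms to the metric and back\<close>

context finsler_domain
begin

lemma F_zero: "x \<in> \<Omega> \<Longrightarrow> F x 0 = 0"
  using finsler by (auto simp: finsler_metric_def)

text \<open>With \<open>P\<close> half the sum of the two terms, \<open>P + F\<close> and
  \<open>P - F\<close> are the terms themselves; adding and subtracting their equations gives the
  coupled system.\<close>

lemma sph_difference_flat_curvature: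
  assumes dim: "CARD('n) \<ge> 2" and cvx: "convex \<Omega>" "0 \<in> \<Omega>" and pq: "q < p"
    and F: "\<And>x y. x \<in> \<Omega> \<Longrightarrow> F x y = (sph_term p x y - sph_term q x y) / 2"
  shows "projectively_flat \<Omega> F \<and> constant_flag_curvature \<Omega> F (-1)"
proof -
  have "continuous_on (\<Omega> \<times> (UNIV - {0})) (\<lambda>(x, y). F x y)"
    using smooth_isCont[OF F_smooth] by (intro continuous_at_imp_continuous_on) auto
  from sph_difference_domain_bound[OF cvx pq this F]
  have small: "p\<^sup>2 * (norm x)\<^sup>2 < 1" "q\<^sup>2 * (norm x)\<^sup>2 < 1" if "x \<in> \<Omega>" for x
    using that by blast+
  have p: "smooth (sph_term p)" and q: "smooth (sph_term q)"
    using small by (auto intro: smooth_sph_term)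
  have half: "smooth (\<lambda>x y. 1 / 2)"
    by (rule smooth_const)
  define P :: "real^'n \<Rightarrow> real^'n \<Rightarrow> real"
    where "P = (\<lambda>x y. 1 / 2 * (sph_term p x y + sph_term q x y))"
  have P: "smooth P"
    unfolding P_def by (intro smooth_mult half smooth_add p q)
  have P_hom: "homogeneous 1 P"
    using homogeneous_sph_term[of p] homogeneous_sph_term[of q]
    by (simp add: homogeneous_def P_def algebra_simps)
  have PF: "pdx l P x y = (pdx l (sph_term p) x y + pdx l (sph_term q) x y) / 2"
    "pdy l P x y = (pdy l (sph_term p) x y + pdy l (sph_term q) x y) / 2"
    "pdx l F x y = (pdx l (sph_term p) x y - pdx l (sph_term q) x y) / 2"
    "pdy l F x y = (pdy l (sph_term p) x y - pdy l (sph_term q) x y) / 2"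
    if xy: "x \<in> \<Omega>" "y \<noteq> 0" for x y l
  proof -
    note rules = pdx_mult[OF half smooth_add[OF p q] xy] pdy_mult[OF half smooth_add[OF p q] xy]
      pdx_mult[OF half smooth_diff[OF p q] xy] pdy_mult[OF half smooth_diff[OF p q] xy]
      pdx_add[OF p q xy] pdy_add[OF p q xy] pdx_diff[OF p q xy] pdy_diff[OF p q xy] pdx_const pdy_const
    show "pdx l P x y = (pdx l (sph_term p) x y + pdx l (sph_term q) x y) / 2"
      "pdy l P x y = (pdy l (sph_term p) x y + pdy l (sph_term q) x y) / 2"
      unfolding P_def rules by simp_all
    have "pdx l F x y = pdx l (\<lambda>x y. 1 / 2 * (sph_term p x y - sph_term q x y)) x y"
      by (rule pdx_cong) (use F xy in auto)
    then show "pdx l F x y = (pdx l (sph_term p) x y - pdx l (sph_term q) x y) / 2"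
      unfolding rules by simp
    have "pdy l F x y = pdy l (\<lambda>x y. 1 / 2 * (sph_term p x y - sph_term q x y)) x y"
      by (rule pdy_cong) (use F xy in auto)
    then show "pdy l F x y = (pdy l (sph_term p) x y - pdy l (sph_term q) x y) / 2"
      unfolding rules by simp
  qed
  show ?thesis
  proof (rule flat_curvatureI[OF dim P P_hom])
    fix x y :: "real^'n" and k :: 'n
    assume xy: "x \<in> \<Omega>" "y \<noteq> 0"
    have pde: "pdx k (sph_term p) x y = sph_term p x y * pdy k (sph_term p) x y"
      "pdx k (sph_term q) x y = sph_term q x y * pdy k (sph_term q) x y"
      using small xy by (auto intro: pdx_sph_term)
    show "pdx k F x y = pdy k P x y * F x y + P x y * pdy k F x y"
      unfolding PF[OF xy] pde F[OF xy(1)] by (simp add: P_def field_simps)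
    show "pdx k P x y = P x y * pdy k P x y + F x y * pdy k F x y"
      unfolding PF[OF xy] pde F[OF xy(1)] by (simp add: P_def field_simps)
  qed
qed

text \<open>Symmetry supplies the initial data: over the origin \<open>F\<close> and
  \<open>P\<close> are multiples \<open>a\<close> and \<open>b\<close> of the norm, so
  \<open>P + F\<close> and \<open>P - F\<close> start with the constants \<open>b + a\<close> and
  \<open>b - a\<close>, which become \<open>p\<close> and \<open>q\<close>.\<close>

lemma flat_curvature_sph_difference:
  assumes dim: "CARD('n) \<ge> 2" and cvx: "convex \<Omega>" "0 \<in> \<Omega>"
    and \<zeta>: "\<And>x y. x \<in> \<Omega> \<Longrightarrow> F x y = norm y * \<zeta> (norm x) ((x \<bullet> y) / norm y)"
    and flat: "projectively_flat \<Omega> F" "constant_flag_curvature \<Omega> F (-1)"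
  obtains p q where "p - q = 2 * \<zeta> 0 0" "\<And>x y. x \<in> \<Omega> \<Longrightarrow> F x y = (sph_term p x y - sph_term q x y) / 2"
proof -
  obtain P where P: "smooth P" "homogeneous 1 P"
    and Fx: "\<And>x y k. x \<in> \<Omega> \<Longrightarrow> y \<noteq> 0 \<Longrightarrow> pdx k F x y = pdy k P x y * F x y + P x y * pdy k F x y"
    and Px: "\<And>x y k. x \<in> \<Omega> \<Longrightarrow> y \<noteq> 0 \<Longrightarrow> pdx k P x y = P x y * pdy k P x y + F x y * pdy k F x y"
    and P_eq: "\<And>x y. x \<in> \<Omega> \<Longrightarrow> y \<noteq> 0 \<Longrightarrow> P x y = (\<Sum>m\<in>UNIV. pdx m F x y * y $ m) / (2 * F x y)"
    by (rule flat_curvature_imp[OF dim flat]) (rule that)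
  define a where "a = \<zeta> 0 0"
  \<comment> \<open>For a unit vector \<open>y\<close>, \<open>F (t y) y\<close> is
    \<open>\<zeta> \<bar>t\<bar> t\<close>, independent of the direction; half its logarithmic
    derivative at 0 is the value of \<open>P\<close>.\<close>
  define b where "b = deriv (\<lambda>t. \<zeta> \<bar>t\<bar> t) 0 / (2 * a)"
  have F0: "F 0 y = a * norm y" for y
    using \<zeta>[OF cvx(2), of y] by (simp add: a_def)
  have P1: "P 0 y = b" if y: "norm y = 1" for y
  proof -
    have "y \<noteq> 0" using y by auto
    have yy: "y \<bullet> y = 1" using y by (simp add: dot_square_norm)
    have "((\<lambda>t. F (t *\<^sub>R y) y) has_real_derivative
        (\<Sum>m\<in>UNIV. y $ m * pdx m F (0 *\<^sub>R y) y) + (\<Sum>m\<in>UNIV. 0 $ m * pdy m F (0 *\<^sub>R y) y)) (at 0)"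
      using smooth_differentiable[OF F_smooth cvx(2) \<open>y \<noteq> 0\<close>]
      by (intro DERIV_curve) (auto intro!: derivative_eq_intros)
    then have "deriv (\<lambda>t. F (t *\<^sub>R y) y) 0 = (\<Sum>m\<in>UNIV. pdx m F 0 y * y $ m)"
      by (simp add: DERIV_imp_deriv mult.commute)
    moreover have "deriv (\<lambda>t. F (t *\<^sub>R y) y) 0 = deriv (\<lambda>t. \<zeta> \<bar>t\<bar> t) 0"
    proof (rule deriv_cong_ev[OF _ refl])
      show "\<forall>\<^sub>F t in nhds 0. F (t *\<^sub>R y) y = \<zeta> \<bar>t\<bar> t"
        using eventually_slit_line(1)[OF cvx(2) \<open>y \<noteq> 0\<close>, of y] by eventually_elim (simp add: \<zeta> y yy)
    qed
    ultimately show ?thesis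
      using P_eq[OF cvx(2) \<open>y \<noteq> 0\<close>] by (simp add: F0 y b_def)
  qed
  have P0: "P 0 y = b * norm y" if y: "y \<noteq> 0" for y
  proof -
    have "P 0 (norm y *\<^sub>R (y /\<^sub>R norm y)) = norm y ^ 1 * P 0 (y /\<^sub>R norm y)"
      using P(2) cvx(2) y unfolding homogeneous_def by (metis norm_eq_zero norm_sgn sgn_div_norm zero_less_norm_iff zero_neq_one)
    then show ?thesis
      using P1[of "y /\<^sub>R norm y"] y by simp
  qed
  have 1: "P x y + F x y = sph_term (b + a) x y" if "x \<in> \<Omega>" "y \<noteq> 0" for x y
  proof (rule funk_solution[OF dim cvx, where \<Phi> = "\<lambda>x y. P x y + F x y"])
    show "smooth (\<lambda>x y. P x y + F x y)"
      by (intro smooth_add P F_smooth)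
    show "pdx l (\<lambda>x y. P x y + F x y) x y = (P x y + F x y) * pdy l (\<lambda>x y. P x y + F x y) x y"
      if "x \<in> \<Omega>" "y \<noteq> 0" for x y l
      unfolding pdx_add[OF P(1) F_smooth that] pdy_add[OF P(1) F_smooth that] Fx[OF that] Px[OF that]
      by (simp add: algebra_simps)
  qed (use that in \<open>simp_all add: P0 F0 algebra_simps\<close>)
  have 2: "P x y - F x y = sph_term (b - a) x y" if "x \<in> \<Omega>" "y \<noteq> 0" for x y
  proof (rule funk_solution[OF dim cvx, where \<Phi> = "\<lambda>x y. P x y - F x y"])
    show "smooth (\<lambda>x y. P x y - F x y)"
      by (intro smooth_diff P F_smooth)
    show "pdx l (\<lambda>x y. P x y - F x y) x y = (P x y - F x y) * pdy l (\<lambda>x y. P x y - F x y) x y"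
      if "x \<in> \<Omega>" "y \<noteq> 0" for x y l
      unfolding pdx_diff[OF P(1) F_smooth that] pdy_diff[OF P(1) F_smooth that] Fx[OF that] Px[OF that]
      by (simp add: algebra_simps)
  qed (use that in \<open>simp_all add: P0 F0 algebra_simps\<close>)
  show thesis
  proof (rule that[of "b + a" "b - a"])
    show "F x y = (sph_term (b + a) x y - sph_term (b - a) x y) / 2" if "x \<in> \<Omega>" for x y
    proof (cases "y = 0")
      case False
      show ?thesis
        unfolding 1[OF that False, symmetric] 2[OF that False, symmetric] by simp
    qed (simp add: sph_term_zero F_zero[OF that])
  qed (simp add: a_def)
qed

end

theorem theorem7p3:
  fixes \<Omega> :: "(real^'n::finite) set"
    and F :: "real^'n \<Rightarrow> real^'n \<Rightarrow> real"
    and \<zeta> :: "real \<Rightarrow> real \<Rightarrow> real"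
  assumes dim: "CARD('n) \<ge> 2"
    and domain: "open \<Omega>" "convex \<Omega>" "\<Omega> \<noteq> {}"
    and finsler: "finsler_metric \<Omega> F"
    and symmetric: "spherically_symmetric \<Omega> F"
    and F_eq: "\<forall>x\<in>\<Omega>. \<forall>y. F x y = norm y * \<zeta> (norm x) ((x \<bullet> y) / norm y)"
  shows "(projectively_flat \<Omega> F \<and> constant_flag_curvature \<Omega> F (-1) \<and> \<zeta> 0 0 = 1
            \<longleftrightarrow> (\<exists>c. \<forall>x\<in>\<Omega>. \<forall>y. F x y = sph_metric c x y))
       \<and> (projectively_flat \<Omega> F \<and> constant_flag_curvature \<Omega> F (-1)
            \<longleftrightarrow> (\<exists>r>0. \<exists>c. \<forall>x\<in>\<Omega>. \<forall>y. F x y = sph_metric c (r *\<^sub>R x) (r *\<^sub>R y)))"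
proof -
  interpret finsler_domain \<Omega> F
    by unfold_locales (fact domain finsler)+
  obtain x where x: "x \<in> \<Omega>"
    using domain by blast
  \<comment> \<open>The midpoint of \<open>x\<close> and \<open>- x\<close> puts the origin, where
    all initial data are taken, into the domain.\<close>
  have "orthogonal_transformation (uminus :: real^'n \<Rightarrow> real^'n)"
    by (simp add: orthogonal_transformation_neg orthogonal_transformation_id[unfolded id_def])
  then have "- x \<in> \<Omega>"
    using symmetric x by (auto simp: spherically_symmetric_def)
  with x have zero: "0 \<in> \<Omega>"
    using convexD[OF domain(2), of x "- x" "1 / 2" "1 / 2"] by simp
  define y\<^sub>0 :: "real^'n" where "y\<^sub>0 = axis undefined 1"
  have y0: "norm y\<^sub>0 = 1" "y\<^sub>0 \<noteq> 0"
    by (auto simp: y\<^sub>0_def axis_eq_0_iff)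
  have F0: "F 0 y\<^sub>0 = \<zeta> 0 0"
    using F_eq zero y0 by simp
  have a: "\<zeta> 0 0 > 0"
    using F_pos[OF zero y0(2)] by (simp add: F0)
  \<comment> \<open>Evaluation over the origin identifies the dilation factor with
    \<open>\<zeta> 0 0\<close>, so \<open>r = 1\<close> yields the normalised equivalence.\<close>
  have scaled: "projectively_flat \<Omega> F \<and> constant_flag_curvature \<Omega> F (-1) \<and> \<zeta> 0 0 = r"
    if "r > 0" and F: "\<And>x y. x \<in> \<Omega> \<Longrightarrow> F x y = sph_metric c (r *\<^sub>R x) (r *\<^sub>R y)" for r c
  proof -
    have "F 0 y\<^sub>0 = r"
      unfolding F[OF zero] sph_metric_scaleR[OF \<open>r > 0\<close>] by (simp add: sph_term_zero y0 algebra_simps)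
    moreover have "(c - 1) * r < (c + 1) * r"
      using \<open>r > 0\<close> by simp
    ultimately show ?thesis
      using sph_difference_flat_curvature[OF dim domain(2) zero] F F0 sph_metric_scaleR[OF \<open>r > 0\<close>] by metis
  qed
  have conv: "\<exists>c. \<forall>x\<in>\<Omega>. \<forall>y. F x y = sph_metric c (\<zeta> 0 0 *\<^sub>R x) (\<zeta> 0 0 *\<^sub>R y)"
    if flat: "projectively_flat \<Omega> F" "constant_flag_curvature \<Omega> F (-1)"
  proof -
    obtain p q where pq: "p - q = 2 * \<zeta> 0 0"
      and F: "\<And>x y. x \<in> \<Omega> \<Longrightarrow> F x y = (sph_term p x y - sph_term q x y) / 2"
      using flat_curvature_sph_difference[OF dim domain(2) zero _ flat] F_eq by blast
    \<comment> \<open>The solution of \<open>(c + 1) r = p\<close> and \<open>(c - 1) r = q\<close>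
      for \<open>r = \<zeta> 0 0\<close>.\<close>
    define c where "c = (p + q) / (2 * \<zeta> 0 0)"
    have "(c + 1) * \<zeta> 0 0 = p" "(c - 1) * \<zeta> 0 0 = q"
      using a pq by (simp_all add: c_def field_simps)
    then have "F x y = sph_metric c (\<zeta> 0 0 *\<^sub>R x) (\<zeta> 0 0 *\<^sub>R y)" if "x \<in> \<Omega>" for x y
      using F[OF that] by (simp add: sph_metric_scaleR[OF a])
    then show ?thesis by blast
  qed
  show ?thesis
    using scaled[of 1] scaled conv a by (metis scaleR_one zero_less_one)
qed

end
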